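(* Let $(\Gamma,\mathcal G)$ be a boundary pair associated with $\mathfrak h$. (i) We have $\operatorname{dom}\Lambda=\operatorname{dom}(S^{*1}S)$ and $$\Lambda=S^{*1}S\ge\frac1{\|\Gamma\|_{1\to0}^2}.$$ In particular, $\Lambda^{-1}=\Gamma\Gamma^{1*}$ exists and is a bounded operator in $\mathcal G$ with norm bounded by $\|\Gamma\|_{1\to0}^2$. (ii) We have $\|\Gamma\|_{1\to0}^2=1/\inf\sigma(\Lambda)$; in particular, the lower bounds $\|S\phi\|_{\mathcal H^1}^2\ge\|\Gamma\|_{1\to0}^{-2}\|\phi\|_{\mathcal G}^2$ ($\phi\in\mathcal G^{1/2}$) and $\Lambda\ge\|\Gamma\|_{1\to0}^{-2}$ are optimal. (iii) The boundary pair is unbounded (i.e. $\operatorname{ran}\Gamma\subsetneq\mathcal G$) iff $\Lambda$ is an unbounded operator.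
   Context: All Hilbert spaces are complex; inner products and sesquilinear forms are linear in the first argument. Let $\mathfrak h$ be a closed, non-negative, densely defined quadratic form in a Hilbert space $\mathcal H$, with domain $\mathcal H^1:=\operatorname{dom}\mathfrak h$, a Hilbert space with norm $\|u\|_{\mathcal H^1}^2=\mathfrak h(u)+\|u\|_{\mathcal H}^2$. A boundary pair associated with $\mathfrak h$ is a pair $(\Gamma,\mathcal G)$ of a Hilbert space $\mathcal G$ and a bounded operator $\Gamma\colon\mathcal H^1\to\mathcal G$ (with norm $\|\Gamma\|_{1\to0}$) such that $\ker\Gamma$ is dense in $\mathcal H$ and $\mathcal G^{1/2}:=\operatorname{ran}\Gamma$ is dense in $\mathcal G$. Let $\mathcal N^1$ be the orthogonal complement of $\ker\Gamma$ in $\mathcal H^1$. The Dirichlet solution operator (at $z=-1$) is $S:=(\Gamma|_{\mathcal N^1})^{-1}\colon\mathcal G^{1/2}\to\mathcal N^1\subset\mathcal H^1$. The form $\mathfrak l(\phi):=\|S\phi\|_{\mathcal H^1}^2$ with $\operatorname{dom}\mathfrak l=\mathcal G^{1/2}$ is closed in $\mathcal G$, and $\Lambda$ (the Dirichlet-to-Neumann operator at $z=-1$) is the self-adjoint operator in $\mathcal G$ associated with $\mathfrak l$. $\Gamma^{1*}\colon\mathcal G\to\mathcal H^1$ is the adjoint of $\Gamma$ with respect to the inner products of $\mathcal H^1$ and $\mathcal G$; $S^{*1}$ is the adjoint of $S$, viewed as a (possibly unbounded) densely defined operator from $\mathcal G$ into $\mathcal H^1$ with domain $\mathcal G^{1/2}$,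 with respect to the inner products of $\mathcal G$ and $\mathcal H^1$. *)

theory Defs
  imports "HOL-Analysis.Analysis"
begin

section \<open>Complex Hilbert spaces\<close>

text \<open>The inner product is linear in its first argument. The inherited norm and topology are
  those of \<^class>\<open>banach\<close>, tied to the inner product by the last axiom.\<close>

class chilbert_space = banach +
  fixes scaleC :: "complex \<Rightarrow> 'a \<Rightarrow> 'a" (infixr "*\<^sub>C" 75)
    and cinner :: "'a \<Rightarrow> 'a \<Rightarrow> complex"
  assumes scaleC_add_right: "a *\<^sub>C (x + y) = a *\<^sub>C x + a *\<^sub>C y"
    and scaleC_add_left: "(a + b) *\<^sub>C x = a *\<^sub>C x + b *\<^sub>C x"
    and scaleC_scaleC: "a *\<^sub>C b *\<^sub>C x = (a * b) *\<^sub>C x"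
    and scaleR_scaleC: "r *\<^sub>R x = complex_of_real r *\<^sub>C x"
    and cinner_add_left: "cinner (x + y) z = cinner x z + cinner y z"
    and cinner_scaleC_left: "cinner (a *\<^sub>C x) y = a * cinner x y"
    and cinner_commute: "cinner x y = cnj (cinner y x)"
    and cinner_self: "cinner x x = complex_of_real ((norm x)\<^sup>2)"

instantiation complex :: chilbert_space
begin
definition "a *\<^sub>C x = a * x" for a x :: complex
definition "cinner x y = x * cnj y" for x y :: complex
instance
  by standard (simp_all add: scaleC_complex_def cinner_complex_def algebra_simps
      scaleR_conv_of_real complex_norm_square del: of_real_power)
end

definition csubspace :: "'a::chilbert_space set \<Rightarrow> bool" where
  "csubspace D \<longleftrightarrow>
     0 \<in> D \<and> (\<forall>x\<in>D. \<forall>y\<in>D. x + y \<in> D) \<and> (\<forall>a. \<forall>x\<in>D. a *\<^sub>C x \<in> D)"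

definition clinear_on :: "'a::chilbert_space set \<Rightarrow> ('a \<Rightarrow> 'b::chilbert_space) \<Rightarrow> bool" where
  "clinear_on D f \<longleftrightarrow>
     (\<forall>x\<in>D. \<forall>y\<in>D. f (x + y) = f x + f y) \<and> (\<forall>a. \<forall>x\<in>D. f (a *\<^sub>C x) = a *\<^sub>C f x)"


section \<open>Operators as graphs\<close>

text \<open>A (not everywhere defined) operator is the set of pairs (argument, value). Its domain is
  \<^const>\<open>Domain\<close>, its inverse is \<^const>\<open>converse\<close>, and the product \<open>A B\<close> (first \<open>B\<close>, then \<open>A\<close>)
  is \<open>B O A\<close>. The norms and inner products are parameters because the form domain, a subset of
  the ambient Hilbert space, carries its own.\<close>

definition graph_on :: "'a set \<Rightarrow> ('a \<Rightarrow> 'b) \<Rightarrow> ('a \<times> 'b) set" where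
  "graph_on D f = {(x, f x) |x. x \<in> D}"

definition linear_relation :: "('a::chilbert_space \<times> 'b::chilbert_space) set \<Rightarrow> bool" where
  "linear_relation T \<longleftrightarrow> (0, 0) \<in> T
     \<and> (\<forall>(x, y)\<in>T. \<forall>(x', y')\<in>T. (x + x', y + y') \<in> T)
     \<and> (\<forall>a. \<forall>(x, y)\<in>T. (a *\<^sub>C x, a *\<^sub>C y) \<in> T)"

definition op_bounded :: "('a \<Rightarrow> real) \<Rightarrow> ('b \<Rightarrow> real) \<Rightarrow> ('a \<times> 'b) set \<Rightarrow> bool" where
  "op_bounded nX nY T \<longleftrightarrow> (\<exists>C. \<forall>(x, y)\<in>T. nY y \<le> C * nX x)"

definition op_norm :: "('a \<Rightarrow> real) \<Rightarrow> ('b \<Rightarrow> real) \<Rightarrow> ('a \<times> 'b) set \<Rightarrow> real" where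
  "op_norm nX nY T = Sup {nY y |x y. (x, y) \<in> T \<and> nX x \<le> 1}"

definition bounded_operator :: "('a::chilbert_space \<times> 'b::chilbert_space) set \<Rightarrow> bool" where
  "bounded_operator T \<longleftrightarrow>
     single_valued T \<and> Domain T = UNIV \<and> linear_relation T \<and> op_bounded norm norm T"

text \<open>The adjoint of an operator between the Hilbert spaces with carriers \<open>X\<close>, \<open>Y\<close> and inner
  products \<open>ipX\<close>, \<open>ipY\<close>.\<close>

definition op_adjoint ::
  "'a set \<Rightarrow> ('a \<Rightarrow> 'a \<Rightarrow> complex) \<Rightarrow> 'b set \<Rightarrow> ('b \<Rightarrow> 'b \<Rightarrow> complex) \<Rightarrow> ('a \<times> 'b) set
    \<Rightarrow> ('b \<times> 'a) set" where
  "op_adjoint X ipX Y ipY T =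
     {(y, x). y \<in> Y \<and> x \<in> X \<and> (\<forall>(u, v)\<in>T. ipY v y = ipX u x)}"

definition resolvent_set :: "('a::chilbert_space \<times> 'a) set \<Rightarrow> complex set" where
  "resolvent_set T = {z. bounded_operator (converse {(x, y - z *\<^sub>C x) |x y. (x, y) \<in> T})}"

definition op_spectrum :: "('a::chilbert_space \<times> 'a) set \<Rightarrow> complex set" where
  "op_spectrum T = - resolvent_set T"

text \<open>The infimum of the spectrum of a self-adjoint operator, whose spectrum is real. It is
  extended real since the spectrum is empty when the space is trivial.\<close>

definition inf_spectrum :: "('a::chilbert_space \<times> 'a) set \<Rightarrow> ereal" where
  "inf_spectrum T = (INF z\<in>op_spectrum T. ereal (Re z))"

text \<open>Lower bounds are extended real, too, so that \<open>1 / 0 = \<infinity>\<close> covers the trivial space, on which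
  \<open>\<infinity>\<close> is a lower bound because of \<open>\<infinity> * 0 = 0\<close>.\<close>

definition op_ge :: "('a::chilbert_space \<times> 'a) set \<Rightarrow> ereal \<Rightarrow> bool" where
  "op_ge T c \<longleftrightarrow> (\<forall>(x, y)\<in>T. cinner y x \<in> \<real> \<and> c * ereal ((norm x)\<^sup>2) \<le> ereal (Re (cinner y x)))"

definition form_ge :: "'a::chilbert_space set \<Rightarrow> ('a \<Rightarrow> real) \<Rightarrow> ereal \<Rightarrow> bool" where
  "form_ge D q c \<longleftrightarrow> (\<forall>x\<in>D. c * ereal ((norm x)\<^sup>2) \<le> ereal (q x))"


section \<open>Quadratic forms\<close>

definition sesquilinear_on :: "'a::chilbert_space set \<Rightarrow> ('a \<Rightarrow> 'a \<Rightarrow> complex) \<Rightarrow> bool" where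
  "sesquilinear_on D b \<longleftrightarrow>
     (\<forall>x\<in>D. \<forall>y\<in>D. \<forall>z\<in>D. b (x + y) z = b x z + b y z \<and> b z (x + y) = b z x + b z y)
   \<and> (\<forall>a. \<forall>x\<in>D. \<forall>y\<in>D. b (a *\<^sub>C x) y = a * b x y \<and> b x (a *\<^sub>C y) = cnj a * b x y)"

text \<open>A real-valued quadratic form \<open>q\<close> with domain \<open>D\<close>; its sesquilinear form is recovered by
  polarisation.\<close>

definition quadratic_form :: "'a::chilbert_space set \<Rightarrow> ('a \<Rightarrow> real) \<Rightarrow> bool" where
  "quadratic_form D q \<longleftrightarrow> csubspace D \<and>
     (\<exists>b. sesquilinear_on D b \<and> (\<forall>u\<in>D. complex_of_real (q u) = b u u))"

definition polar :: "('a::chilbert_space \<Rightarrow> real) \<Rightarrow> 'a \<Rightarrow> 'a \<Rightarrow> complex" where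
  "polar q u v = (\<Sum>k<4::nat. \<i> ^ k * complex_of_real (q (u + \<i> ^ k *\<^sub>C v))) / 4"

text \<open>The operator associated with the form \<open>q\<close> with domain \<open>D\<close> (first representation theorem).\<close>

definition form_operator :: "'a::chilbert_space set \<Rightarrow> ('a \<Rightarrow> real) \<Rightarrow> ('a \<times> 'a) set" where
  "form_operator D q = {(x, y). x \<in> D \<and> (\<forall>v\<in>D. polar q x v = cinner y v)}"

text \<open>For a non-negative form \<open>h\<close>, the inner product and norm that its domain carries.\<close>

definition form_inner :: "('a::chilbert_space \<Rightarrow> real) \<Rightarrow> 'a \<Rightarrow> 'a \<Rightarrow> complex" where
  "form_inner h u v = polar h u v + cinner u v"

definition form_norm :: "('a::chilbert_space \<Rightarrow> real) \<Rightarrow> 'a \<Rightarrow> real" where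
  "form_norm h u = sqrt (h u + (norm u)\<^sup>2)"

text \<open>Closedness is completeness of the form domain with respect to \<^const>\<open>form_norm\<close>.\<close>

definition closed_form :: "'a::chilbert_space set \<Rightarrow> ('a \<Rightarrow> real) \<Rightarrow> bool" where
  "closed_form D h \<longleftrightarrow> (\<forall>u. (\<forall>n. u n \<in> D)
      \<and> (\<forall>e>0. \<exists>N::nat. \<forall>m\<ge>N. \<forall>n\<ge>N. form_norm h (u m - u n) < e)
      \<longrightarrow> (\<exists>v\<in>D. (\<lambda>n. form_norm h (u n - v)) \<longlonglongrightarrow> 0))"

definition closed_nonneg_form :: "'a::chilbert_space set \<Rightarrow> ('a \<Rightarrow> real) \<Rightarrow> bool" where
  "closed_nonneg_form D h \<longleftrightarrow>
     quadratic_form D h \<and> closure D = UNIV \<and> (\<forall>u\<in>D. 0 \<le> h u) \<and> closed_form D h"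


section \<open>Boundary pairs\<close>

text \<open>Throughout, \<open>D\<close> is the domain of the form \<open>h\<close>, \<open>\<G>\<close> is the whole type \<open>'g\<close>, and only the
  values of \<open>\<Gamma>\<close> on \<open>D\<close> matter.\<close>

definition bp_ker :: "'h::chilbert_space set \<Rightarrow> ('h \<Rightarrow> 'g::chilbert_space) \<Rightarrow> 'h set" where
  "bp_ker D \<Gamma> = {u \<in> D. \<Gamma> u = 0}"

definition boundary_pair ::
  "'h::chilbert_space set \<Rightarrow> ('h \<Rightarrow> real) \<Rightarrow> ('h \<Rightarrow> 'g::chilbert_space) \<Rightarrow> bool" where
  "boundary_pair D h \<Gamma> \<longleftrightarrow>
     clinear_on D \<Gamma> \<and> op_bounded (form_norm h) norm (graph_on D \<Gamma>)
   \<and> closure (bp_ker D \<Gamma>) = UNIV \<and> closure (\<Gamma> ` D) = UNIV"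

definition bp_norm :: "'h::chilbert_space set \<Rightarrow> ('h \<Rightarrow> real) \<Rightarrow> ('h \<Rightarrow> 'g::chilbert_space) \<Rightarrow> real"
  where "bp_norm D h \<Gamma> = op_norm (form_norm h) norm (graph_on D \<Gamma>)"

definition bp_N1 ::
  "'h::chilbert_space set \<Rightarrow> ('h \<Rightarrow> real) \<Rightarrow> ('h \<Rightarrow> 'g::chilbert_space) \<Rightarrow> 'h set" where
  "bp_N1 D h \<Gamma> = {u \<in> D. \<forall>w\<in>bp_ker D \<Gamma>. form_inner h u w = 0}"

text \<open>The Dirichlet solution operator; only its values on \<open>\<Gamma> ` D\<close> are meaningful.\<close>

definition bp_S ::
  "'h::chilbert_space set \<Rightarrow> ('h \<Rightarrow> real) \<Rightarrow> ('h \<Rightarrow> 'g::chilbert_space) \<Rightarrow> 'g \<Rightarrow> 'h" where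
  "bp_S D h \<Gamma> = inv_into (bp_N1 D h \<Gamma>) \<Gamma>"

definition bp_form ::
  "'h::chilbert_space set \<Rightarrow> ('h \<Rightarrow> real) \<Rightarrow> ('h \<Rightarrow> 'g::chilbert_space) \<Rightarrow> 'g \<Rightarrow> real" where
  "bp_form D h \<Gamma> \<phi> = (form_norm h (bp_S D h \<Gamma> \<phi>))\<^sup>2"

text \<open>The Dirichlet-to-Neumann operator.\<close>

definition bp_DtN ::
  "'h::chilbert_space set \<Rightarrow> ('h \<Rightarrow> real) \<Rightarrow> ('h \<Rightarrow> 'g::chilbert_space) \<Rightarrow> ('g \<times> 'g) set" where
  "bp_DtN D h \<Gamma> = form_operator (\<Gamma> ` D) (bp_form D h \<Gamma>)"

definition bp_S_graph ::
  "'h::chilbert_space set \<Rightarrow> ('h \<Rightarrow> real) \<Rightarrow> ('h \<Rightarrow> 'g::chilbert_space) \<Rightarrow> ('g \<times> 'h) set" where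
  "bp_S_graph D h \<Gamma> = graph_on (\<Gamma> ` D) (bp_S D h \<Gamma>)"

text \<open>The adjoints of \<open>\<Gamma>\<close> and \<open>S\<close> with respect to the inner products of the form domain and of
  the boundary space.\<close>

definition bp_\<Gamma>_adj ::
  "'h::chilbert_space set \<Rightarrow> ('h \<Rightarrow> real) \<Rightarrow> ('h \<Rightarrow> 'g::chilbert_space) \<Rightarrow> ('g \<times> 'h) set" where
  "bp_\<Gamma>_adj D h \<Gamma> = op_adjoint D (form_inner h) UNIV cinner (graph_on D \<Gamma>)"

definition bp_S_adj ::
  "'h::chilbert_space set \<Rightarrow> ('h \<Rightarrow> real) \<Rightarrow> ('h \<Rightarrow> 'g::chilbert_space) \<Rightarrow> ('h \<times> 'g) set" where
  "bp_S_adj D h \<Gamma> = op_adjoint UNIV cinner D (form_inner h) (bp_S_graph D h \<Gamma>)"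

end

theory Submission
  imports Defs
begin

text \<open>Everything is expressed through the bounded, symmetric, injective operator \<open>B = \<Gamma> \<Gamma>\<^sup>1\<^sup>*\<close>:
  both \<open>\<Lambda> \<phi> = \<psi>\<close> and \<open>S\<^sup>*\<^sup>1 S \<phi> = \<psi>\<close> amount to \<open>S \<phi> = \<Gamma>\<^sup>1\<^sup>* \<psi>\<close>, that is, to \<open>\<phi> = B \<psi>\<close>. The adjoint
  \<open>\<Gamma>\<^sup>1\<^sup>*\<close> and the solution operator \<open>S\<close> come from the Riesz representation theorem on \<open>D\<close> and on
  \<open>ker \<Gamma>\<close>. The lower bound \<open>1 / \<parallel>\<Gamma>\<parallel>\<^sup>2\<close> of \<open>\<Lambda>\<close> puts everything to its left into the resolvent set,
  and it cannot be improved, so it is itself spectral. Finally, if \<open>\<Gamma>\<close> is onto, then uniform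
  boundedness applied to \<open>{\<psi>. \<parallel>\<Gamma>\<^sup>1\<^sup>* \<psi>\<parallel> \<le> 1}\<close> bounds \<open>\<Lambda>\<close>; conversely, if \<open>\<Lambda>\<close> is bounded, then \<open>B\<close>
  is bounded below and hence onto.\<close>

section \<open>Inner products on subspaces\<close>

lemma scaleC_one [simp]: "1 *\<^sub>C (x::'a::chilbert_space) = x"
  using scaleR_scaleC[of 1 x] by simp

lemma scaleC_zero_left [simp]: "0 *\<^sub>C (x::'a::chilbert_space) = 0"
  using scaleR_scaleC[of 0 x] by simp

lemma scaleC_zero_right [simp]: "a *\<^sub>C (0::'a::chilbert_space) = 0"
  using scaleC_add_right[of a 0 0] by simp

lemma scaleC_minus_one [simp]: "(- 1) *\<^sub>C (x::'a::chilbert_space) = - x"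
  using scaleR_scaleC[of "-1" x] by simp

lemma scaleC_minus_right [simp]: "a *\<^sub>C (- x::'a::chilbert_space) = - (a *\<^sub>C x)"
  using scaleC_add_right[of a x "- x"] by (simp add: eq_neg_iff_add_eq_0 add.commute)

lemma scaleC_diff_right: "a *\<^sub>C (x - y::'a::chilbert_space) = a *\<^sub>C x - a *\<^sub>C y"
  using scaleC_add_right[of a x "- y"] by simp

lemma cinner_add_right: "cinner x (y + z) = cinner x y + cinner x (z::'a::chilbert_space)"
  by (metis cinner_add_left cinner_commute complex_cnj_add)

lemma cinner_scaleC_right: "cinner x (a *\<^sub>C y) = cnj a * cinner x (y::'a::chilbert_space)"
  by (metis cinner_scaleC_left cinner_commute complex_cnj_mult)

lemma csubspace_UNIV: "csubspace UNIV"
  by (simp add: csubspace_def)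

text \<open>The source of both Cauchy-Schwarz and the vanishing first variation in the Riesz
  argument. The degenerate case \<open>c = 0\<close> has to be covered because \<open>c\<close> will
  be a squared norm that may vanish.\<close>

lemma quadratic_nonneg_imp_discriminant:
  fixes a b c :: real
  assumes nonneg: "\<And>t. 0 \<le> a + 2 * t * b + t\<^sup>2 * c"
  shows "b\<^sup>2 \<le> a * c"
proof (cases "c = 0")
  case True
  have "b = 0"
  proof (rule ccontr)
    assume "b \<noteq> 0"
    \<comment> \<open>This \<open>t\<close> makes \<open>a + 2 * t * b\<close> equal to
      \<open>-1\<close>.\<close>
    then show False using nonneg[of "- (a + 1) / (2 * b)"] True by (simp add: field_simps)
  qed
  then show ?thesis using True by simp
next
  case False
  have "c \<ge> 0"
  proof (rule ccontr)
    assume c: "\<not> c \<ge> 0"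
    \<comment> \<open>For negative \<open>c\<close> the quadratic term must win: \<open>t\<close> is
      at least 1, so \<open>\<bar>a\<bar>\<close> can be absorbed into
      \<open>t * \<bar>a\<bar>\<close>, and large enough that the whole polynomial is at most
      \<open>- t\<close>.\<close>
    define t where "t = (2 * \<bar>b\<bar> + \<bar>a\<bar> + 1) / (- c) + 1"
    have t: "t \<ge> 1" "- c * t \<ge> 2 * \<bar>b\<bar> + \<bar>a\<bar> + 1" using c by (auto simp: t_def field_simps)
    have "t * b \<le> t * \<bar>b\<bar>" using t(1) by (intro mult_left_mono) auto
    moreover have "a \<le> t * \<bar>a\<bar>" using mult_right_mono[OF t(1), of "\<bar>a\<bar>"] by simp
    moreover have "t * (- c * t) \<ge> t * (2 * \<bar>b\<bar> + \<bar>a\<bar> + 1)" using t by (intro mult_left_mono) auto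
    moreover have "0 \<le> a + 2 * (t * b) - t * (- c * t)"
      using nonneg[of t] by (simp add: power2_eq_square algebra_simps)
    ultimately show False using t(1) unfolding distrib_left by linarith
  qed
  \<comment> \<open>The minimum of the parabola is at \<open>- b / c\<close>.\<close>
  then show ?thesis using nonneg[of "- b / c"] False by (simp add: power2_eq_square field_simps)
qed

text \<open>The carrier is a set and the inner product a parameter, so that one theory serves the
  form domain, the kernel of \<open>\<Gamma>\<close>, ranges of operators and whole spaces.\<close>

locale pre_hilbert_on =
  fixes D :: "'a::chilbert_space set" and ip :: "'a \<Rightarrow> 'a \<Rightarrow> complex"
  assumes subspace: "csubspace D"
    and sesquilinear: "sesquilinear_on D ip"
    and ip_commute: "x \<in> D \<Longrightarrow> y \<in> D \<Longrightarrow> ip x y = cnj (ip y x)"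
    and ip_nonneg: "x \<in> D \<Longrightarrow> 0 \<le> Re (ip x x)"
begin

definition nrm :: "'a \<Rightarrow> real" where
  "nrm x = sqrt (Re (ip x x))"

lemma zero_mem [simp, intro]: "0 \<in> D"
  and add_mem [simp, intro]: "x \<in> D \<Longrightarrow> y \<in> D \<Longrightarrow> x + y \<in> D"
  and scaleC_mem [simp, intro]: "x \<in> D \<Longrightarrow> a *\<^sub>C x \<in> D"
  using subspace by (auto simp: csubspace_def)

lemma scaleR_mem [simp, intro]: "x \<in> D \<Longrightarrow> t *\<^sub>R x \<in> D"
  by (simp add: scaleR_scaleC)

lemma minus_mem [simp, intro]: "x \<in> D \<Longrightarrow> - x \<in> D"
  using scaleC_mem[of x "-1"] by simp

lemma diff_mem [simp, intro]: "x \<in> D \<Longrightarrow> y \<in> D \<Longrightarrow> x - y \<in> D"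
  using add_mem[of x "- y"] by simp

lemma ip_add_left: "x \<in> D \<Longrightarrow> y \<in> D \<Longrightarrow> z \<in> D \<Longrightarrow> ip (x + y) z = ip x z + ip y z"
  and ip_add_right: "x \<in> D \<Longrightarrow> y \<in> D \<Longrightarrow> z \<in> D \<Longrightarrow> ip z (x + y) = ip z x + ip z y"
  and ip_scaleC_left: "x \<in> D \<Longrightarrow> y \<in> D \<Longrightarrow> ip (a *\<^sub>C x) y = a * ip x y"
  and ip_scaleC_right: "x \<in> D \<Longrightarrow> y \<in> D \<Longrightarrow> ip x (a *\<^sub>C y) = cnj a * ip x y"
  using sesquilinear by (auto simp: sesquilinear_on_def)

lemma ip_scaleR_left: "x \<in> D \<Longrightarrow> y \<in> D \<Longrightarrow> ip (t *\<^sub>R x) y = t * ip x y"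
  and ip_scaleR_right: "x \<in> D \<Longrightarrow> y \<in> D \<Longrightarrow> ip x (t *\<^sub>R y) = t * ip x y"
  by (simp_all add: scaleR_scaleC ip_scaleC_left ip_scaleC_right)

lemma ip_minus_left: "x \<in> D \<Longrightarrow> y \<in> D \<Longrightarrow> ip (- x) y = - ip x y"
  and ip_minus_right: "x \<in> D \<Longrightarrow> y \<in> D \<Longrightarrow> ip x (- y) = - ip x y"
  using ip_scaleC_left[of x y "-1"] ip_scaleC_right[of x y "-1"] by simp_all

lemma ip_diff_left: "x \<in> D \<Longrightarrow> y \<in> D \<Longrightarrow> z \<in> D \<Longrightarrow> ip (x - y) z = ip x z - ip y z"
  and ip_diff_right: "x \<in> D \<Longrightarrow> y \<in> D \<Longrightarrow> z \<in> D \<Longrightarrow> ip z (x - y) = ip z x - ip z y"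
  using ip_add_left[of x "- y" z] ip_add_right[of x "- y" z]
  by (simp_all add: ip_minus_left ip_minus_right)

lemma ip_zero_left [simp]: "x \<in> D \<Longrightarrow> ip 0 x = 0"
  using ip_scaleC_left[of x x 0] by simp

lemma ip_zero_right [simp]: "x \<in> D \<Longrightarrow> ip x 0 = 0"
  using ip_scaleC_right[of x x 0] by simp

lemma Re_ip_commute: "x \<in> D \<Longrightarrow> y \<in> D \<Longrightarrow> Re (ip x y) = Re (ip y x)"
  using ip_commute[of x y] by simp

lemma nrm_nonneg [simp]: "x \<in> D \<Longrightarrow> 0 \<le> nrm x"
  by (simp add: nrm_def ip_nonneg)

lemma nrm_square: "x \<in> D \<Longrightarrow> (nrm x)\<^sup>2 = Re (ip x x)"
  by (simp add: nrm_def ip_nonneg)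

lemma nrm_add_scaleR_square:
  assumes "x \<in> D" "y \<in> D"
  shows "(nrm (x + t *\<^sub>R y))\<^sup>2 = (nrm x)\<^sup>2 + 2 * t * Re (ip x y) + t\<^sup>2 * (nrm y)\<^sup>2"
  using assms Re_ip_commute[OF assms]
  by (simp add: nrm_square ip_add_left ip_add_right ip_scaleR_left ip_scaleR_right)
    (simp add: power2_eq_square algebra_simps)

lemma nrm_scaleR: "x \<in> D \<Longrightarrow> nrm (t *\<^sub>R x) = \<bar>t\<bar> * nrm x"
  by (simp add: nrm_def ip_scaleR_left ip_scaleR_right real_sqrt_mult flip: mult.assoc)

lemma Re_ip_le:
  assumes x: "x \<in> D" and y: "y \<in> D"
  shows "Re (ip x y) \<le> nrm x * nrm y"
proof -
  have "(Re (ip x y))\<^sup>2 \<le> (nrm x)\<^sup>2 * (nrm y)\<^sup>2"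
  proof (rule quadratic_nonneg_imp_discriminant)
    fix t :: real
    show "0 \<le> (nrm x)\<^sup>2 + 2 * t * Re (ip x y) + t\<^sup>2 * (nrm y)\<^sup>2"
      using nrm_add_scaleR_square[OF x y, of t] by (metis zero_le_power2)
  qed
  then have "(Re (ip x y))\<^sup>2 \<le> (nrm x * nrm y)\<^sup>2" by (simp add: power_mult_distrib)
  then show ?thesis by (rule power2_le_imp_le) (simp add: x y)
qed

lemma abs_Re_ip_le: "x \<in> D \<Longrightarrow> y \<in> D \<Longrightarrow> \<bar>Re (ip x y)\<bar> \<le> nrm x * nrm y"
  using Re_ip_le[of x y] Re_ip_le[of "- x" y] nrm_scaleR[of x "-1"]
  by (simp add: ip_minus_left abs_le_iff)

text \<open>Replacing \<open>x\<close> by \<open>\<i> *\<^sub>C x\<close> turns imaginary parts into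
  real parts, so variational arguments need only treat real parts.\<close>

lemma complex_eq_from_Re:
  assumes "clinear_on D f" "clinear_on D g" "\<And>x. x \<in> D \<Longrightarrow> Re (f x) = Re (g x)" "x \<in> D"
  shows "f x = (g x :: complex)"
proof (rule complex_eqI)
  show "Re (f x) = Re (g x)" using assms by blast
  have "f (\<i> *\<^sub>C x) = \<i> * f x" "g (\<i> *\<^sub>C x) = \<i> * g x"
    using assms(1,2,4) by (auto simp: clinear_on_def scaleC_complex_def)
  then show "Im (f x) = Im (g x)" using assms(3)[of "\<i> *\<^sub>C x"] assms(4) by simp
qed

lemma clinear_on_ip: "y \<in> D \<Longrightarrow> clinear_on D (\<lambda>x. ip x y)"
  by (simp add: clinear_on_def ip_add_left ip_scaleC_left scaleC_complex_def)

end

locale hilbert_on = pre_hilbert_on +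
  assumes complete_on:
    "\<And>u. (\<And>n::nat. u n \<in> D) \<Longrightarrow> (\<And>e. e > 0 \<Longrightarrow> \<exists>N. \<forall>m\<ge>N. \<forall>n\<ge>N. nrm (u m - u n) < e)
      \<Longrightarrow> \<exists>v\<in>D. (\<lambda>n. nrm (u n - v)) \<longlonglongrightarrow> 0"
begin

text \<open>A minimising sequence of \<open>\<parallel>u\<parallel>\<^sup>2 - 2 Re f(u)\<close> is Cauchy by the parallelogram law, and its
  limit represents \<open>f\<close>.\<close>

lemma riesz:
  assumes f: "clinear_on D f" and C: "\<And>u. u \<in> D \<Longrightarrow> Re (f u) \<le> C * nrm u"
  shows "\<exists>w\<in>D. \<forall>u\<in>D. f u = ip u w"
proof -
  define J where "J u = (nrm u)\<^sup>2 - 2 * Re (f u)" for u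
  define m where "m = Inf (J ` D)"
  have f_add: "f (x + y) = f x + f y" and f_scaleR: "f (t *\<^sub>R x) = t * f x"
    if "x \<in> D" "y \<in> D" for x y t
    using f that by (auto simp: clinear_on_def scaleR_scaleC scaleC_complex_def)
  have J_expand: "J (u + t *\<^sub>R v) = J u + t * (2 * Re (ip u v) - 2 * Re (f v)) + t\<^sup>2 * (nrm v)\<^sup>2"
    if "u \<in> D" "v \<in> D" for u v t
    using that by (simp add: J_def nrm_add_scaleR_square f_add f_scaleR algebra_simps)
  have J_low: "- C\<^sup>2 \<le> J u" if "u \<in> D" for u
  proof -
    have "0 \<le> (nrm u - C)\<^sup>2" by simp
    then show ?thesis using C[OF that] by (simp add: J_def power2_eq_square algebra_simps)
  qed
  have bdd: "bdd_below (J ` D)" using J_low by (intro bdd_belowI2[where m = "- C\<^sup>2"])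
  have m_le: "m \<le> J u" if "u \<in> D" for u
    unfolding m_def using that bdd by (intro cInf_lower) auto
  have "\<exists>u. u \<in> D \<and> J u < m + 1 / Suc n" for n
    using cInf_lessD[of "J ` D" "m + 1 / Suc n"] zero_mem unfolding m_def by fastforce
  then obtain u where u: "\<And>n. u n \<in> D" and Ju: "\<And>n. J (u n) < m + 1 / Suc n" by metis
  have par: "(nrm (u k - u n))\<^sup>2 \<le> 2 / Suc k + 2 / Suc n" for k n
  proof -
    define v where "v = u k - u n"
    have v: "v \<in> D" using u by (simp add: v_def)
    define b where "b = 2 * Re (ip (u n) v) - 2 * Re (f v)"
    have "J (u n + 1 *\<^sub>R v) = J (u k)" by (simp add: v_def)
    then have "J (u k) = J (u n) + b + (nrm v)\<^sup>2"
      using J_expand[OF u v, of n 1] by (simp add: b_def)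
    moreover have "m \<le> J (u n + (1/2) *\<^sub>R v)" using u v by (intro m_le) auto
    then have "m \<le> J (u n) + b / 2 + (nrm v)\<^sup>2 / 4"
      using J_expand[OF u v, of n "1/2"] by (simp add: b_def power2_eq_square)
    ultimately show ?thesis
      using Ju[of n] Ju[of k] unfolding v_def[symmetric] by linarith
  qed
  have "\<exists>N. \<forall>k\<ge>N. \<forall>n\<ge>N. nrm (u k - u n) < e" if e: "e > 0" for e
  proof -
    obtain N where N: "1 / Suc N < e\<^sup>2 / 4" using e nat_approx_posE[of "e\<^sup>2 / 4"] by auto
    have "nrm (u k - u n) < e" if "k \<ge> N" "n \<ge> N" for k n
    proof -
      have "2 / real (Suc k) \<le> 2 / Suc N" "2 / real (Suc n) \<le> 2 / Suc N"
        using that by (auto intro!: divide_left_mono)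
      then have "(nrm (u k - u n))\<^sup>2 < e\<^sup>2" using par[of k n] N by simp
      then show ?thesis using e by (simp add: power_less_imp_less_base)
    qed
    then show ?thesis by blast
  qed
  then have "\<exists>w\<in>D. (\<lambda>n. nrm (u n - w)) \<longlonglongrightarrow> 0"
    by (intro complete_on u)
  then obtain w where w: "w \<in> D" and lim: "(\<lambda>n. nrm (u n - w)) \<longlonglongrightarrow> 0"
    by blast
  have Re_eq: "Re (f v) = Re (ip v w)" if v: "v \<in> D" for v
  proof -
    have "(\<lambda>n. Re (ip (u n - w) v)) \<longlonglongrightarrow> 0"
    proof (rule tendsto_0_le)
      show "\<forall>\<^sub>F n in sequentially. norm (Re (ip (u n - w) v)) \<le> norm (nrm (u n - w)) * nrm v"
        using u w v by (auto intro!: always_eventually abs_Re_ip_le)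
    qed (fact lim)
    then have L: "(\<lambda>n. Re (ip (u n) v)) \<longlonglongrightarrow> Re (ip w v)"
      using u w v by (simp add: ip_diff_left LIM_zero_iff)
    \<comment> \<open>Passing to the limit in \<open>m \<le> J (u n + t *\<^sub>R v)\<close> leaves
      a non-negative quadratic in \<open>t\<close> with constant term 0; the discriminant bound then
      forces its linear coefficient to vanish.\<close>
    have "(Re (ip w v) - Re (f v))\<^sup>2 \<le> 0 * (nrm v)\<^sup>2"
    proof (rule quadratic_nonneg_imp_discriminant)
      fix t :: real
      have lim2: "(\<lambda>n. 1 / Suc n + 2 * t * (Re (ip (u n) v) - Re (f v)) + t\<^sup>2 * (nrm v)\<^sup>2)
          \<longlonglongrightarrow> 0 + 2 * t * (Re (ip w v) - Re (f v)) + t\<^sup>2 * (nrm v)\<^sup>2"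
        by (intro tendsto_intros L LIMSEQ_Suc[OF lim_1_over_n])
      have "0 \<le> 1 / Suc n + 2 * t * (Re (ip (u n) v) - Re (f v)) + t\<^sup>2 * (nrm v)\<^sup>2" for n
        using m_le[of "u n + t *\<^sub>R v"] J_expand[OF u v, of n t] u v Ju[of n]
        by (simp add: algebra_simps)
      then show "0 \<le> 0 + 2 * t * (Re (ip w v) - Re (f v)) + t\<^sup>2 * (nrm v)\<^sup>2"
        using LIMSEQ_le_const[OF lim2] by blast
    qed
    then show ?thesis using Re_ip_commute[OF v w] by simp
  qed
  have "f v = ip v w" if "v \<in> D" for v
    by (rule complex_eq_from_Re[OF f clinear_on_ip[OF w] Re_eq that])
  then show ?thesis using w by blast
qed

end

section \<open>Complete subspaces with the inherited inner product, and bounded operators\<close>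

lemma pre_hilbert_on_cinner: "csubspace X \<Longrightarrow> pre_hilbert_on X cinner"
  by unfold_locales
    (auto simp: sesquilinear_on_def cinner_add_left cinner_add_right cinner_scaleC_left
      cinner_scaleC_right cinner_self intro: cinner_commute)

lemma nrm_cinner: "pre_hilbert_on.nrm cinner = norm"
  using pre_hilbert_on.nrm_def[OF pre_hilbert_on_cinner[OF csubspace_UNIV]] by (auto simp: cinner_self)

lemma hilbert_on_cinner:
  assumes "csubspace X" "complete X"
  shows "hilbert_on X cinner"
proof -
  interpret pre_hilbert_on X cinner by (rule pre_hilbert_on_cinner) fact
  show ?thesis
  proof
    fix u :: "nat \<Rightarrow> 'a"
    assume u: "\<And>n. u n \<in> X"
      and "\<And>e. e > 0 \<Longrightarrow> \<exists>N. \<forall>m\<ge>N. \<forall>n\<ge>N. nrm (u m - u n) < e"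
    then have "Cauchy u" by (simp add: nrm_cinner Cauchy_iff)
    then obtain v where "v \<in> X" "u \<longlonglongrightarrow> v"
      using assms(2) u unfolding complete_def by blast
    then show "\<exists>v\<in>X. (\<lambda>n. nrm (u n - v)) \<longlonglongrightarrow> 0"
      using tendsto_norm_zero[OF LIM_zero, of u v sequentially]
      by (auto simp: nrm_cinner)
  qed
qed

interpretation G: hilbert_on UNIV "cinner :: 'g::chilbert_space \<Rightarrow> 'g \<Rightarrow> complex"
  rewrites "pre_hilbert_on.nrm (cinner :: 'g \<Rightarrow> 'g \<Rightarrow> complex) = norm"
  by (simp_all add: hilbert_on_cinner csubspace_UNIV complete_UNIV nrm_cinner)

text \<open>The class gives homogeneity of the norm only for real scalars; the complex case comes
  from the inner product.\<close>

lemma norm_scaleC: "norm (a *\<^sub>C (x::'a::chilbert_space)) = cmod a * norm x"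
proof -
  have "complex_of_real ((norm (a *\<^sub>C x))\<^sup>2) = a * cnj a * cinner x x"
    by (simp only: cinner_scaleC_left cinner_scaleC_right mult_ac flip: cinner_self)
  also have "\<dots> = complex_of_real ((cmod a * norm x)\<^sup>2)"
    by (simp only: cinner_self complex_norm_square power_mult_distrib of_real_mult)
  finally show ?thesis by (simp only: of_real_eq_iff) simp
qed

lemma cinner_eq_zero_all:
  assumes "\<And>x. cinner x y = 0"
  shows "y = (0::'a::chilbert_space)"
  using assms[of y] by (simp add: cinner_self)

lemma bounded_linear_Re_cinner: "bounded_linear (\<lambda>x. Re (cinner x (y::'a::chilbert_space)))"
  using G.abs_Re_ip_le[of _ y]
  by (intro bounded_linear_intro[where K = "norm y"])
    (auto simp: cinner_add_left G.ip_scaleR_left)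

text \<open>The range of \<open>A\<close> is closed, and its orthogonal complement is the kernel of the adjoint.\<close>

lemma bounded_below_surj:
  fixes A A' :: "'a::chilbert_space \<Rightarrow> 'a"
  assumes lin: "clinear_on UNIV A"
    and bounded: "\<And>x. norm (A x) \<le> K * norm x"
    and below: "\<And>x. norm x \<le> C * norm (A x)"
    and adj: "\<And>x y. cinner (A x) y = cinner x (A' y)"
    and inj: "\<And>y. A' y = 0 \<Longrightarrow> y = 0"
  shows "surj A"
proof -
  have add: "A (x + y) = A x + A y" and scaleC: "A (a *\<^sub>C x) = a *\<^sub>C A x" for x y a
    using lin by (auto simp: clinear_on_def)
  interpret A: bounded_linear A
    using bounded by (intro bounded_linear_intro[where K = K])
      (auto simp: add scaleC scaleR_scaleC mult.commute)
  have "csubspace (range A)"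
    unfolding csubspace_def by (auto simp flip: add scaleC) (metis A.zero rangeI)
  moreover have "complete (range A)"
  proof (rule complete_isometric_image)
    \<comment> \<open>The constant \<open>C\<close> may fail to be positive, hence
      \<open>\<bar>C\<bar> + 1\<close>.\<close>
    show "0 < inverse (\<bar>C\<bar> + 1)" by simp
    show "\<forall>x\<in>UNIV. inverse (\<bar>C\<bar> + 1) * norm x \<le> norm (A x)"
    proof
      fix x
      have "norm x \<le> (\<bar>C\<bar> + 1) * norm (A x)"
        by (rule order_trans[OF below]) (simp add: mult_right_mono)
      then show "inverse (\<bar>C\<bar> + 1) * norm x \<le> norm (A x)" by (simp add: field_simps)
    qed
  qed (auto simp: A.bounded_linear_axioms complete_UNIV)
  ultimately interpret R: hilbert_on "range A" cinner by (rule hilbert_on_cinner)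
  have nrm: "R.nrm = norm" by (rule nrm_cinner)
  have "\<phi> \<in> range A" for \<phi>
  proof -
    have "clinear_on (range A) (\<lambda>u. cinner u \<phi>)"
      by (simp add: clinear_on_def cinner_add_left cinner_scaleC_left scaleC_complex_def)
    \<comment> \<open>Here \<open>r\<close> is the orthogonal projection of \<open>\<phi>\<close>
      onto the range of \<open>A\<close>.\<close>
    then obtain r where r: "r \<in> range A" "\<forall>u\<in>range A. cinner u \<phi> = cinner u r"
      using R.riesz[of "\<lambda>u. cinner u \<phi>" "norm \<phi>"] G.Re_ip_le[of _ \<phi>]
      by (auto simp: nrm mult.commute)
    have "cinner x (A' (\<phi> - r)) = 0" for x
      using r(2) by (simp flip: adj add: G.ip_diff_right)
    then have "A' (\<phi> - r) = 0" by (rule cinner_eq_zero_all)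
    then show ?thesis using inj[of "\<phi> - r"] r(1) by simp
  qed
  then show ?thesis by blast
qed

text \<open>Uniform boundedness by Baire: the closed sets \<open>F n\<close> cover the space, so one
  of them contains a ball around some \<open>a\<close>. Testing \<open>y\<close> with the point of
  the ball that lies from \<open>a\<close> in the direction of \<open>y\<close> bounds
  \<open>norm y\<close>, once the contribution of \<open>a\<close> is removed by the bound at
  \<open>- a\<close>.\<close>

lemma weakly_bounded_imp_bounded:
  fixes Y :: "'a::chilbert_space set"
  assumes weak: "\<And>x. \<exists>C. \<forall>y\<in>Y. Re (cinner x y) \<le> C"
  shows "\<exists>C. \<forall>y\<in>Y. norm y \<le> C"
proof -
  define F where "F n = {x. \<forall>y\<in>Y. Re (cinner x y) \<le> real n}" for n :: nat
  have closed: "closed (F n)" for n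
  proof -
    have "F n = (\<Inter>y\<in>Y. {x. Re (cinner x y) \<le> real n})" by (auto simp: F_def)
    then show ?thesis
      by (auto intro!: closed_INT closed_Collect_le continuous_intros
          linear_continuous_on bounded_linear_Re_cinner)
  qed
  have "x \<in> \<Union>(range F)" for x
  proof -
    obtain C where "\<forall>y\<in>Y. Re (cinner x y) \<le> C" using weak by blast
    moreover obtain n :: nat where "C \<le> n" using real_arch_simple by blast
    ultimately show ?thesis by (auto simp: F_def intro!: exI[of _ n])
  qed
  then have "\<Union>(range F) = UNIV" by blast
  moreover have "interior (\<Union>(range F)) = {}" if "\<And>n. interior (F n) = {}"
    using Baire_category_alt[of euclidean "range F"] closed that
    by (auto simp: completely_metrizable_space_euclidean)
  ultimately obtain n where "interior (F n) \<noteq> {}" by fastforce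
  then obtain a e where e: "e > 0" and ball: "ball a e \<subseteq> F n"
    by (metis ex_in_conv mem_interior)
  obtain C where C: "\<And>y. y \<in> Y \<Longrightarrow> Re (cinner (- a) y) \<le> C" using weak[of "- a"] by blast
  have "norm y \<le> 2 * (\<bar>C\<bar> + n) / e" if y: "y \<in> Y" for y
  proof (cases "y = 0")
    case False
    have "a + (e / 2 / norm y) *\<^sub>R y \<in> F n"
      using ball e False by (auto simp: dist_norm)
    then have "Re (cinner a y) + e / 2 * norm y \<le> n"
      using y False by (auto simp: F_def cinner_add_left G.ip_scaleR_left cinner_self power2_eq_square
          simp del: of_real_power of_real_mult dest!: bspec)
    then show ?thesis using C[OF y] e by (simp add: G.ip_minus_left field_simps)
  qed (use e in simp)
  then show ?thesis by blast
qed

section \<open>Sesquilinear forms and polarisation\<close>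

lemma sesquilinear_add_scaleC:
  assumes D: "csubspace D" and b: "sesquilinear_on D b" and u: "u \<in> D" and v: "v \<in> D"
  shows "b (u + a *\<^sub>C v) (u + a *\<^sub>C v) = b u u + cnj a * b u v + a * b v u + a * cnj a * b v v"
proof -
  have mem: "a *\<^sub>C v \<in> D" "u + a *\<^sub>C v \<in> D"
    using D u v by (auto simp: csubspace_def)
  have add: "b (x + y) z = b x z + b y z" "b z (x + y) = b z x + b z y"
    and scale: "b (a *\<^sub>C x) y = a * b x y" "b x (a *\<^sub>C y) = cnj a * b x y"
    if "x \<in> D" "y \<in> D" "z \<in> D" for x y z a
    using b that by (auto simp: sesquilinear_on_def)
  show ?thesis
    using u v mem by (simp add: add scale[where z = u] algebra_simps)
qed

text \<open>In the sum over the four powers of \<open>\<i>\<close> only the term with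
  \<open>b u v\<close> has total weight \<open>\<i> ^ k * cnj (\<i> ^ k) = 1\<close>; the others
  cancel.\<close>

lemma polar_eq:
  assumes "csubspace D" "sesquilinear_on D b"
    and q: "\<And>u. u \<in> D \<Longrightarrow> complex_of_real (q u) = b u u"
    and u: "u \<in> D" and v: "v \<in> D"
  shows "polar q u v = b u v"
proof -
  have "u + a *\<^sub>C v \<in> D" for a
    using assms by (auto simp: csubspace_def)
  then have "complex_of_real (q (u + a *\<^sub>C v))
      = b u u + cnj a * b u v + a * b v u + a * cnj a * b v v" for a
    by (simp add: q sesquilinear_add_scaleC[OF assms(1,2) u v])
  then show ?thesis
    by (simp add: polar_def numeral_eq_Suc algebra_simps)
qed

text \<open>The diagonal value at \<open>u + a *\<^sub>C v\<close> is real; \<open>a = 1\<close>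
  compares the imaginary parts of \<open>b u v\<close> and \<open>b v u\<close>, and
  \<open>a = \<i>\<close> their real parts.\<close>

lemma sesquilinear_real_diagonal_commute:
  assumes "csubspace D" "sesquilinear_on D b"
    and real: "\<And>u. u \<in> D \<Longrightarrow> b u u \<in> \<real>"
    and u: "u \<in> D" and v: "v \<in> D"
  shows "b u v = cnj (b v u)"
proof -
  have "u + a *\<^sub>C v \<in> D" for a
    using assms by (auto simp: csubspace_def)
  then have "Im (b u u + cnj a * b u v + a * b v u + a * cnj a * b v v) = 0" for a
    using real[of "u + a *\<^sub>C v"]
    by (simp only: sesquilinear_add_scaleC[OF assms(1,2) u v] complex_is_Real_iff)
  from this[of 1] this[of \<i>] show ?thesis
    using real[OF u] real[OF v] by (simp add: complex_eq_iff complex_is_Real_iff)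
qed

text \<open>Reduces optimality among extended real bounds \<open>c\<close> to finite positive
  \<open>r\<close> below \<open>c\<close>. For \<open>m = 0\<close> the right-hand side is
  \<infinity>.\<close>

lemma ereal_le_one_divide:
  assumes m: "m \<ge> 0" and r: "\<And>r. r > 0 \<Longrightarrow> ereal r \<le> c \<Longrightarrow> r * m \<le> 1"
  shows "c \<le> 1 / ereal m"
proof (cases "m = 0")
  case True
  then show ?thesis by (simp add: divide_ereal_def)
next
  case False
  show ?thesis
  proof (rule ccontr)
    assume "\<not> c \<le> 1 / ereal m"
    then have "ereal (1 / m) < c" using False by (simp add: divide_ereal_def inverse_eq_divide)
    then obtain t where t: "1 / m < t" "ereal t < c" using ereal_dense2 by force
    have "1 / m > 0" using m False by simp
    then have "t > 0" using t by linarith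
    then have "t * m \<le> 1" using r t by simp
    then show False using t m False by (simp add: field_simps)
  qed
qed

text \<open>For \<open>m = 0\<close> the last assumption forces \<open>x = 0\<close>, and the
  product \<infinity> times 0 is 0.\<close>

lemma one_divide_ereal_mult_le:
  assumes "m \<ge> 0" "x \<ge> 0" "r \<ge> 0" "x \<le> m * r"
  shows "1 / ereal m * ereal x \<le> ereal r"
proof (cases "m = 0")
  case True
  then show ?thesis using assms by simp
next
  case False
  then show ?thesis using assms by (simp add: divide_ereal_def field_simps)
qed

section \<open>The Dirichlet-to-Neumann operator\<close>

locale boundary_pair_of_form =
  fixes D :: "'h::chilbert_space set" and h :: "'h \<Rightarrow> real"
    and \<Gamma> :: "'h \<Rightarrow> 'g::chilbert_space"
  assumes form: "closed_nonneg_form D h" and pair: "boundary_pair D h \<Gamma>"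
begin

section \<open>The form domain as a Hilbert space\<close>

abbreviation ip1 :: "'h \<Rightarrow> 'h \<Rightarrow> complex" where "ip1 \<equiv> form_inner h"
abbreviation n1 :: "'h \<Rightarrow> real" where "n1 \<equiv> form_norm h"

lemma csubspace_D: "csubspace D" and h_nonneg: "u \<in> D \<Longrightarrow> 0 \<le> h u"
  using form by (auto simp: closed_nonneg_form_def quadratic_form_def)

text \<open>On \<open>D\<close> polarisation recovers the sesquilinear form that the definition of a
  quadratic form only asserts to exist, so \<open>ip1\<close> inherits its algebra.\<close>

lemma form_inner_sesquilinear: "sesquilinear_on D ip1"
  and form_inner_self: "u \<in> D \<Longrightarrow> ip1 u u = complex_of_real (h u + (norm u)\<^sup>2)"
proof -
  obtain b where b: "sesquilinear_on D b" and h: "\<And>u. u \<in> D \<Longrightarrow> complex_of_real (h u) = b u u"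
    using form by (auto simp: closed_nonneg_form_def quadratic_form_def)
  have ip1: "ip1 u v = b u v + cinner u v" if "u \<in> D" "v \<in> D" for u v
    using polar_eq[OF csubspace_D b h] that by (simp add: form_inner_def)
  have mem: "x + y \<in> D" "a *\<^sub>C x \<in> D" if "x \<in> D" "y \<in> D" for x y a
    using csubspace_D that by (auto simp: csubspace_def)
  show "sesquilinear_on D ip1"
    using b unfolding sesquilinear_on_def
    by (simp add: ip1 mem cinner_add_left cinner_add_right cinner_scaleC_left cinner_scaleC_right
        algebra_simps)
  show "u \<in> D \<Longrightarrow> ip1 u u = complex_of_real (h u + (norm u)\<^sup>2)"
    by (simp add: ip1 h cinner_self)
qed

lemma form_norm_eq: "u \<in> D \<Longrightarrow> n1 u = sqrt (Re (ip1 u u))"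
  by (simp add: form_norm_def form_inner_self)

lemma form_inner_self_norm: "u \<in> D \<Longrightarrow> ip1 u u = complex_of_real ((n1 u)\<^sup>2)"
  by (simp add: form_norm_def form_inner_self h_nonneg)

sublocale H: pre_hilbert_on D ip1
proof
  show "ip1 x y = cnj (ip1 y x)" if "x \<in> D" "y \<in> D" for x y
    using that by (intro sesquilinear_real_diagonal_commute[OF csubspace_D form_inner_sesquilinear])
      (simp_all only: form_inner_self Reals_of_real)
qed (simp_all add: csubspace_D form_inner_sesquilinear form_inner_self h_nonneg)

lemma nrm_eq: "u \<in> D \<Longrightarrow> H.nrm u = n1 u"
  by (simp add: H.nrm_def form_norm_eq)

sublocale H: hilbert_on D ip1
proof
  fix u :: "nat \<Rightarrow> 'h"
  assume u: "\<And>n. u n \<in> D" and "\<And>e. e > 0 \<Longrightarrow> \<exists>N. \<forall>m\<ge>N. \<forall>n\<ge>N. H.nrm (u m - u n) < e"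
  then have "\<forall>e>0. \<exists>N. \<forall>m\<ge>N. \<forall>n\<ge>N. n1 (u m - u n) < e" by (simp add: nrm_eq)
  then have "\<exists>v\<in>D. (\<lambda>n. n1 (u n - v)) \<longlonglongrightarrow> 0"
    using form[unfolded closed_nonneg_form_def closed_form_def] u
    by (elim conjE allE[of _ u]) simp
  then show "\<exists>v\<in>D. (\<lambda>n. H.nrm (u n - v)) \<longlonglongrightarrow> 0" using u by (auto simp: nrm_eq)
qed

lemma n1_nonneg: "u \<in> D \<Longrightarrow> 0 \<le> n1 u"
  using H.nrm_nonneg nrm_eq by simp

lemma ip1_self_eq_zero_imp: "u \<in> D \<Longrightarrow> ip1 u u = 0 \<Longrightarrow> u = 0"
  using h_nonneg[of u] by (simp add: form_inner_self add_nonneg_eq_0_iff del: of_real_add of_real_power)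

lemma Re_ip1_le: "u \<in> D \<Longrightarrow> v \<in> D \<Longrightarrow> Re (ip1 u v) \<le> n1 u * n1 v"
  using H.Re_ip_le[of u v] by (simp add: nrm_eq)

section \<open>The boundary map and its norm\<close>

lemma \<Gamma>_add: "u \<in> D \<Longrightarrow> v \<in> D \<Longrightarrow> \<Gamma> (u + v) = \<Gamma> u + \<Gamma> v"
  and \<Gamma>_scaleC: "u \<in> D \<Longrightarrow> \<Gamma> (a *\<^sub>C u) = a *\<^sub>C \<Gamma> u"
  using pair by (auto simp: boundary_pair_def clinear_on_def)

lemma \<Gamma>_zero [simp]: "\<Gamma> 0 = 0"
  using \<Gamma>_add[of 0 0] by simp

lemma \<Gamma>_diff: "u \<in> D \<Longrightarrow> v \<in> D \<Longrightarrow> \<Gamma> (u - v) = \<Gamma> u - \<Gamma> v"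
  using \<Gamma>_add[of u "- v"] \<Gamma>_scaleC[of v "-1"] by simp

abbreviation M :: real where "M \<equiv> bp_norm D h \<Gamma>"

lemma M_eq: "M = Sup {norm (\<Gamma> u) |u. u \<in> D \<and> n1 u \<le> 1}"
  by (simp add: bp_norm_def op_norm_def graph_on_def)

lemma n1_zero [simp]: "n1 0 = 0"
  using form_norm_eq[of 0] by simp

lemma \<Gamma>_bounded: "\<exists>C\<ge>0. \<forall>u\<in>D. norm (\<Gamma> u) \<le> C * n1 u"
proof -
  obtain C where C: "\<And>u. u \<in> D \<Longrightarrow> norm (\<Gamma> u) \<le> C * n1 u"
    using pair by (auto simp: boundary_pair_def op_bounded_def graph_on_def)
  \<comment> \<open>The constant in \<open>op_bounded\<close> may be negative;
    \<open>max C 0\<close> repairs this.\<close>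
  have "norm (\<Gamma> u) \<le> max C 0 * n1 u" if "u \<in> D" for u
    using C[OF that] mult_right_mono[of C "max C 0", OF _ n1_nonneg[OF that]] by simp
  then show ?thesis by (intro exI[of _ "max C 0"]) auto
qed

lemma norm_\<Gamma>_le_M: assumes "u \<in> D" "n1 u \<le> 1" shows "norm (\<Gamma> u) \<le> M"
proof -
  obtain C where C: "C \<ge> 0" "\<And>u. u \<in> D \<Longrightarrow> norm (\<Gamma> u) \<le> C * n1 u"
    using \<Gamma>_bounded by blast
  have "norm (\<Gamma> u) \<le> C" if "u \<in> D" "n1 u \<le> 1" for u
    using C(2)[OF that(1)] mult_left_mono[OF that(2) C(1)] by simp
  then show ?thesis
    unfolding M_eq using assms by (intro cSup_upper) (auto intro!: bdd_aboveI[where M = C])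
qed

lemma M_nonneg: "M \<ge> 0"
  using norm_\<Gamma>_le_M[of 0] by simp

lemma norm_\<Gamma>_le: assumes u: "u \<in> D" shows "norm (\<Gamma> u) \<le> M * n1 u"
proof (cases "n1 u = 0")
  case True
  then show ?thesis using \<Gamma>_bounded u by (metis mult_zero_right)
next
  case False
  then have pos: "n1 u > 0" using n1_nonneg[OF u] by simp
  have "n1 ((1 / n1 u) *\<^sub>R u) = 1"
    using H.nrm_scaleR[OF u, of "1 / n1 u"] u pos by (simp add: nrm_eq)
  then have "norm (\<Gamma> ((1 / n1 u) *\<^sub>R u)) \<le> M" using u by (intro norm_\<Gamma>_le_M) auto
  then show ?thesis
    using u pos by (simp add: scaleR_scaleC \<Gamma>_scaleC norm_scaleC norm_divide field_simps)
qed

lemma M_le: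
  assumes "K \<ge> 0" "\<And>u. u \<in> D \<Longrightarrow> norm (\<Gamma> u) \<le> K * n1 u"
  shows "M \<le> K"
  unfolding M_eq
proof (rule cSup_least)
  show "{norm (\<Gamma> u) |u. u \<in> D \<and> n1 u \<le> 1} \<noteq> {}" using H.zero_mem n1_zero by fastforce
  fix x assume "x \<in> {norm (\<Gamma> u) |u. u \<in> D \<and> n1 u \<le> 1}"
  then obtain u where u: "x = norm (\<Gamma> u)" "u \<in> D" "n1 u \<le> 1" by blast
  show "x \<le> K" using assms(2)[OF u(2)] mult_left_mono[OF u(3) assms(1)] u(1) by simp
qed

section \<open>The adjoint of the boundary map and the operator \<open>B\<close>\<close>

text \<open>The adjoint of \<open>\<Gamma>\<close> as a total function: the Riesz representative of
  the functional sending \<open>u\<close> to \<open>cinner (\<Gamma> u) \<phi>\<close>.\<close>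

definition \<Gamma>s :: "'g \<Rightarrow> 'h" where
  "\<Gamma>s \<phi> = (SOME w. w \<in> D \<and> (\<forall>u\<in>D. cinner (\<Gamma> u) \<phi> = ip1 u w))"

lemma \<Gamma>s: "\<Gamma>s \<phi> \<in> D" "u \<in> D \<Longrightarrow> ip1 u (\<Gamma>s \<phi>) = cinner (\<Gamma> u) \<phi>"
proof -
  have "clinear_on D (\<lambda>u. cinner (\<Gamma> u) \<phi>)"
    by (simp add: clinear_on_def \<Gamma>_add \<Gamma>_scaleC cinner_add_left cinner_scaleC_left
        scaleC_complex_def)
  moreover have "Re (cinner (\<Gamma> u) \<phi>) \<le> (M * norm \<phi>) * H.nrm u" if "u \<in> D" for u
    using G.Re_ip_le[of "\<Gamma> u" \<phi>] mult_right_mono[OF norm_\<Gamma>_le[OF that], of "norm \<phi>"]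
    by (simp add: nrm_eq that mult_ac)
  ultimately have "\<exists>w. w \<in> D \<and> (\<forall>u\<in>D. cinner (\<Gamma> u) \<phi> = ip1 u w)"
    using H.riesz[of "\<lambda>u. cinner (\<Gamma> u) \<phi>" "M * norm \<phi>"] by blast
  from someI_ex[OF this] show "\<Gamma>s \<phi> \<in> D" "u \<in> D \<Longrightarrow> ip1 u (\<Gamma>s \<phi>) = cinner (\<Gamma> u) \<phi>"
    unfolding \<Gamma>s_def by auto
qed

lemma \<Gamma>s_unique:
  assumes w: "w \<in> D" and "\<And>u. u \<in> D \<Longrightarrow> ip1 u w = cinner (\<Gamma> u) \<phi>"
  shows "\<Gamma>s \<phi> = w"
proof -
  have "ip1 (\<Gamma>s \<phi> - w) (\<Gamma>s \<phi> - w) = 0"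
    using assms \<Gamma>s by (simp add: H.ip_diff_right)
  then show ?thesis using ip1_self_eq_zero_imp[of "\<Gamma>s \<phi> - w"] \<Gamma>s(1) w by simp
qed

lemma clinear_\<Gamma>s: "clinear_on UNIV \<Gamma>s"
  unfolding clinear_on_def
  by (auto intro!: \<Gamma>s_unique simp: \<Gamma>s H.ip_add_right H.ip_scaleC_right cinner_add_right
      cinner_scaleC_right)

definition B :: "'g \<Rightarrow> 'g" where "B \<phi> = \<Gamma> (\<Gamma>s \<phi>)"

lemma clinear_B: "clinear_on UNIV B"
  using clinear_\<Gamma>s by (simp add: clinear_on_def B_def \<Gamma>_add \<Gamma>_scaleC \<Gamma>s)

lemma B_add: "B (x + y) = B x + B y" and B_scaleC: "B (a *\<^sub>C x) = a *\<^sub>C B x"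
  using clinear_B by (auto simp: clinear_on_def)

lemma B_scaleR: "B (t *\<^sub>R x) = t *\<^sub>R B x"
  by (simp add: scaleR_scaleC B_scaleC)

lemma cinner_B: "cinner (B x) y = ip1 (\<Gamma>s x) (\<Gamma>s y)"
  by (simp add: B_def \<Gamma>s)

lemma B_sym: "cinner (B x) y = cinner x (B y)"
  using H.ip_commute[of "\<Gamma>s x" "\<Gamma>s y"] cinner_commute[of x "B y"] \<Gamma>s(1) by (simp add: cinner_B)

lemma cinner_B_self: "cinner y (B y) = complex_of_real ((n1 (\<Gamma>s y))\<^sup>2)"
  using cinner_B[of y y] form_inner_self_norm[OF \<Gamma>s(1)] by (simp add: B_sym)

lemma norm_B_le_\<Gamma>s: "norm (B y) \<le> M * n1 (\<Gamma>s y)"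
  unfolding B_def by (rule norm_\<Gamma>_le) (rule \<Gamma>s)

text \<open>The lower bound of \<Lambda> in terms of its inverse: elements of the domain have the
  form \<open>B y\<close>, with \<Lambda> taking \<open>B y\<close> to \<open>y\<close>.\<close>

lemma norm_B_square_le: "(norm (B y))\<^sup>2 \<le> M\<^sup>2 * Re (cinner y (B y))"
  using power_mono[OF norm_B_le_\<Gamma>s, of y 2] by (simp add: cinner_B_self power_mult_distrib)

lemma norm_B_le: "norm (B y) \<le> M\<^sup>2 * norm y"
proof (cases "B y = 0")
  case False
  have "norm (B y) * norm (B y) \<le> M\<^sup>2 * Re (cinner y (B y))"
    using norm_B_square_le[of y] by (simp add: power2_eq_square)
  also have "\<dots> \<le> M\<^sup>2 * (norm y * norm (B y))"
    by (intro mult_left_mono G.Re_ip_le) auto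
  finally show ?thesis using False by (simp add: mult.assoc[symmetric])
qed simp

text \<open>If \<open>B y = 0\<close>, then \<open>\<Gamma>s y\<close> has norm 0, so
  \<open>y\<close> is orthogonal to the range of \<open>\<Gamma>\<close>, which is dense.\<close>

lemma B_inj: assumes "B y = 0" shows "y = 0"
proof -
  have "n1 (\<Gamma>s y) = 0" using cinner_B_self[of y] assms by simp
  then have "\<Gamma>s y = 0" using ip1_self_eq_zero_imp[OF \<Gamma>s(1)] by (simp add: form_inner_self_norm \<Gamma>s)
  then have "\<Gamma> ` D \<subseteq> {v. Re (cinner v y) = 0}"
    using \<Gamma>s(2)[of _ y] by auto
  moreover have "closed {v. Re (cinner v y) = 0}"
    by (intro closed_Collect_eq continuous_intros linear_continuous_on bounded_linear_Re_cinner)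
  ultimately have "closure (\<Gamma> ` D) \<subseteq> {v. Re (cinner v y) = 0}" by (rule closure_minimal)
  then have "Re (cinner y y) = 0" using pair by (auto simp: boundary_pair_def)
  then show ?thesis by (simp add: cinner_self)
qed

section \<open>The kernel, its orthogonal complement and the solution operator\<close>

abbreviation ker\<Gamma> :: "'h set" where "ker\<Gamma> \<equiv> bp_ker D \<Gamma>"
abbreviation N1 :: "'h set" where "N1 \<equiv> bp_N1 D h \<Gamma>"
abbreviation S :: "'g \<Rightarrow> 'h" where "S \<equiv> bp_S D h \<Gamma>"

text \<open>Completeness survives because \<open>\<Gamma>\<close> is bounded in the form norm, which
  makes its kernel closed in \<open>D\<close>.\<close>

lemma ker_hilbert: "hilbert_on ker\<Gamma> ip1"
proof -
  have sub: "x \<in> D" if "x \<in> ker\<Gamma>" for x using that by (simp add: bp_ker_def)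
  interpret K: pre_hilbert_on ker\<Gamma> ip1
  proof
    show "csubspace ker\<Gamma>"
      by (auto simp: csubspace_def bp_ker_def \<Gamma>_add \<Gamma>_scaleC)
    show "sesquilinear_on ker\<Gamma> ip1"
      using sub unfolding sesquilinear_on_def
      by (simp add: H.ip_add_left H.ip_add_right H.ip_scaleC_left H.ip_scaleC_right)
  qed (use sub H.ip_commute H.ip_nonneg in blast)+
  show ?thesis
  proof
    fix u :: "nat \<Rightarrow> 'h"
    assume u: "\<And>n. u n \<in> ker\<Gamma>" and C: "\<And>e. e > 0 \<Longrightarrow> \<exists>N. \<forall>m\<ge>N. \<forall>n\<ge>N. K.nrm (u m - u n) < e"
    have uD: "u n \<in> D" for n using u sub by simp
    have "\<exists>v\<in>D. (\<lambda>n. H.nrm (u n - v)) \<longlonglongrightarrow> 0"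
      using uD C by (rule H.complete_on)
    then obtain v where v: "v \<in> D" and lim: "(\<lambda>n. H.nrm (u n - v)) \<longlonglongrightarrow> 0" by blast
    have "norm (\<Gamma> v) \<le> M * H.nrm (u n - v)" for n
      using norm_\<Gamma>_le[of "u n - v"] u[of n] uD v by (simp add: nrm_eq \<Gamma>_diff bp_ker_def)
    then have "norm (\<Gamma> v) \<le> M * 0"
      by (intro LIMSEQ_le_const[OF tendsto_mult_left[OF lim]]) auto
    then have "v \<in> ker\<Gamma>" using v by (simp add: bp_ker_def)
    then show "\<exists>v\<in>ker\<Gamma>. (\<lambda>n. K.nrm (u n - v)) \<longlonglongrightarrow> 0" using lim by auto
  qed
qed

lemma N1_D: "u \<in> N1 \<Longrightarrow> u \<in> D"
  and N1_orth: "u \<in> N1 \<Longrightarrow> w \<in> D \<Longrightarrow> \<Gamma> w = 0 \<Longrightarrow> ip1 u w = 0"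
  by (auto simp: bp_N1_def bp_ker_def)

lemma \<Gamma>s_N1: "\<Gamma>s \<phi> \<in> N1"
proof -
  have "ip1 (\<Gamma>s \<phi>) w = 0" if "w \<in> D" "\<Gamma> w = 0" for w
    using \<Gamma>s that H.ip_commute[of "\<Gamma>s \<phi>" w] by simp
  then show ?thesis by (simp add: bp_N1_def bp_ker_def \<Gamma>s)
qed

lemma N1_add: "u \<in> N1 \<Longrightarrow> v \<in> N1 \<Longrightarrow> u + v \<in> N1"
  and N1_scaleC: "u \<in> N1 \<Longrightarrow> a *\<^sub>C u \<in> N1"
  by (auto simp: bp_N1_def bp_ker_def H.ip_add_left H.ip_scaleC_left)

text \<open>Subtracting from \<open>u\<close> its projection onto the kernel, obtained from Riesz
  there, lands in \<open>N1\<close> without changing the boundary value.\<close>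

lemma N1_decomposition:
  assumes u: "u \<in> D"
  shows "\<exists>n\<in>N1. \<Gamma> n = \<Gamma> u"
proof -
  interpret K: hilbert_on ker\<Gamma> ip1 by (rule ker_hilbert)
  have sub: "x \<in> D" "\<Gamma> x = 0" if "x \<in> ker\<Gamma>" for x using that by (simp_all add: bp_ker_def)
  have "clinear_on ker\<Gamma> (\<lambda>x. ip1 x u)"
    using H.clinear_on_ip[OF u] sub by (simp add: clinear_on_def)
  moreover have "Re (ip1 x u) \<le> n1 u * K.nrm x" if "x \<in> ker\<Gamma>" for x
    using Re_ip1_le[of x u] u sub(1)[OF that] by (simp add: K.nrm_def form_norm_eq mult.commute)
  ultimately obtain w where w: "w \<in> ker\<Gamma>" and eq: "\<And>x. x \<in> ker\<Gamma> \<Longrightarrow> ip1 x u = ip1 x w"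
    using K.riesz[of "\<lambda>x. ip1 x u" "n1 u"] by blast
  have "ip1 (u - w) x = 0" if "x \<in> ker\<Gamma>" for x
    using H.ip_commute[of "u - w" x] eq[OF that] u sub[OF w] sub[OF that]
    by (simp add: H.ip_diff_right)
  then have "u - w \<in> N1" using u sub[OF w] by (simp add: bp_N1_def)
  then show ?thesis using u sub[OF w] by (intro bexI[of _ "u - w"]) (auto simp: \<Gamma>_diff)
qed

lemma inj_on_N1: "inj_on \<Gamma> N1"
proof
  fix u v assume uv: "u \<in> N1" "v \<in> N1" "\<Gamma> u = \<Gamma> v"
  have D: "u \<in> D" "v \<in> D" using uv N1_D by auto
  have "\<Gamma> (u - v) = 0" using D uv by (simp add: \<Gamma>_diff)
  then have "ip1 (u - v) (u - v) = 0"
    using D uv N1_orth[of _ "u - v"] by (simp add: H.ip_diff_left)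
  then show "u = v" using ip1_self_eq_zero_imp[of "u - v"] D by simp
qed

lemma S_eq: "n \<in> N1 \<Longrightarrow> \<Gamma> n = \<phi> \<Longrightarrow> S \<phi> = n"
  unfolding bp_S_def using inv_into_f_f[OF inj_on_N1] by blast

lemma S: assumes "\<phi> \<in> \<Gamma> ` D" shows "S \<phi> \<in> N1" "S \<phi> \<in> D" "\<Gamma> (S \<phi>) = \<phi>"
  using assms N1_decomposition S_eq N1_D by (metis imageE)+

lemma csubspace_ran: "csubspace (\<Gamma> ` D)"
  unfolding csubspace_def
  by (auto simp flip: \<Gamma>_add \<Gamma>_scaleC) (metis H.zero_mem \<Gamma>_zero image_eqI)

lemma polar_bp_form:
  assumes "\<phi> \<in> \<Gamma> ` D" "\<psi> \<in> \<Gamma> ` D"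
  shows "polar (bp_form D h \<Gamma>) \<phi> \<psi> = ip1 (S \<phi>) (S \<psi>)"
proof (rule polar_eq[OF csubspace_ran _ _ assms])
  \<comment> \<open>\<open>S\<close> is linear on the range: sums and multiples of its values stay
    in \<open>N1\<close>, where \<open>\<Gamma>\<close> is injective.\<close>
  have "S (x + y) = S x + S y" "S (a *\<^sub>C x) = a *\<^sub>C S x" if "x \<in> \<Gamma> ` D" "y \<in> \<Gamma> ` D" for x y a
    using S[OF that(1)] S[OF that(2)] by (auto intro!: S_eq simp: N1_add N1_scaleC \<Gamma>_add \<Gamma>_scaleC)
  then show "sesquilinear_on (\<Gamma> ` D) (\<lambda>\<phi> \<psi>. ip1 (S \<phi>) (S \<psi>))"
    unfolding sesquilinear_on_def
    by (simp add: S H.ip_add_left H.ip_add_right H.ip_scaleC_left H.ip_scaleC_right)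
  show "complex_of_real (bp_form D h \<Gamma> \<phi>) = ip1 (S \<phi>) (S \<phi>)" if "\<phi> \<in> \<Gamma> ` D" for \<phi>
    using that by (simp add: bp_form_def form_inner_self_norm S)
qed

text \<open>The difference \<open>u - S (\<Gamma> u)\<close> lies in the kernel, to which
  \<open>S \<phi>\<close> is orthogonal.\<close>

lemma ip1_S: assumes "\<phi> \<in> \<Gamma> ` D" "u \<in> D" shows "ip1 (S \<phi>) u = ip1 (S \<phi>) (S (\<Gamma> u))"
proof -
  have Su: "S (\<Gamma> u) \<in> D" "\<Gamma> (S (\<Gamma> u)) = \<Gamma> u" using S[of "\<Gamma> u"] assms by auto
  then have "ip1 (S \<phi>) (u - S (\<Gamma> u)) = 0"
    using S[OF assms(1)] assms by (intro N1_orth) (auto simp: \<Gamma>_diff)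
  then show ?thesis using S[OF assms(1)] assms Su by (simp add: H.ip_diff_right)
qed

text \<open>\<open>S\<close> selects the extension of least form norm. This links \<open>M\<close>,
  a supremum over all of \<open>D\<close>, to the form, which sees only the values of
  \<open>S\<close>.\<close>

lemma n1_S_le: assumes "u \<in> D" shows "n1 (S (\<Gamma> u)) \<le> n1 u"
proof (cases "n1 (S (\<Gamma> u)) = 0")
  case False
  have Su: "S (\<Gamma> u) \<in> D" using S[of "\<Gamma> u"] assms by auto
  have "(n1 (S (\<Gamma> u)))\<^sup>2 = Re (ip1 (S (\<Gamma> u)) u)"
    using ip1_S[of "\<Gamma> u" u] assms form_inner_self_norm[OF Su] by simp
  also have "\<dots> \<le> n1 (S (\<Gamma> u)) * n1 u" using Su assms by (rule Re_ip1_le)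
  finally show ?thesis using False n1_nonneg[OF Su] by (simp add: power2_eq_square)
qed (use assms n1_nonneg in simp)

text \<open>\<open>\<Gamma>s \<psi>\<close> lies in \<open>N1\<close>, hence is \<open>S\<close> of
  its own boundary value \<open>B \<psi>\<close>. Membership in the range is stated because
  \<open>S\<close> is arbitrary elsewhere.\<close>

lemma S_eq_\<Gamma>s_iff: "\<phi> \<in> \<Gamma> ` D \<and> S \<phi> = \<Gamma>s \<psi> \<longleftrightarrow> \<phi> = B \<psi>"
  using S_eq[OF \<Gamma>s_N1, of \<psi>] S(3)[of \<phi>] \<Gamma>s(1)[of \<psi>] by (auto simp: B_def)

text \<open>Testing with values of \<open>S\<close> alone suffices, since the remaining part of a
  vector in \<open>D\<close> is orthogonal to \<open>S \<phi>\<close>.\<close>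

lemma S_eq_\<Gamma>s_iff_inner:
  assumes "\<phi> \<in> \<Gamma> ` D"
  shows "S \<phi> = \<Gamma>s \<psi> \<longleftrightarrow> (\<forall>v\<in>\<Gamma> ` D. ip1 (S v) (S \<phi>) = cinner v \<psi>)"
proof
  assume "S \<phi> = \<Gamma>s \<psi>"
  then show "\<forall>v\<in>\<Gamma> ` D. ip1 (S v) (S \<phi>) = cinner v \<psi>" by (simp add: S \<Gamma>s)
next
  assume eq: "\<forall>v\<in>\<Gamma> ` D. ip1 (S v) (S \<phi>) = cinner v \<psi>"
  have "ip1 u (S \<phi>) = cinner (\<Gamma> u) \<psi>" if u: "u \<in> D" for u
  proof -
    have "ip1 u (S \<phi>) = cnj (ip1 (S \<phi>) (S (\<Gamma> u)))"
      using H.ip_commute[OF u S(2)[OF assms]] ip1_S[OF assms u] by simp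
    also have "\<dots> = ip1 (S (\<Gamma> u)) (S \<phi>)"
      using u by (intro H.ip_commute[symmetric] S assms imageI)
    finally show ?thesis using eq u by simp
  qed
  then show "S \<phi> = \<Gamma>s \<psi>" by (rule \<Gamma>s_unique[OF S(2)[OF assms], symmetric])
qed

section \<open>The Dirichlet-to-Neumann operator and the two products as graphs of \<open>B\<close>
  or its inverse\<close>

lemma DtN_eq: "bp_DtN D h \<Gamma> = {(B y, y) |y. True}"
proof -
  have "(x, y) \<in> bp_DtN D h \<Gamma> \<longleftrightarrow> x = B y" for x y
  proof -
    \<comment> \<open>The two defining conditions are complex conjugates: the form operator tests in
      the second argument, the adjoint in the first.\<close>
    have "polar (bp_form D h \<Gamma>) x v = cinner y v \<longleftrightarrow> ip1 (S v) (S x) = cinner v y"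
      if "x \<in> \<Gamma> ` D" "v \<in> \<Gamma> ` D" for v
      unfolding polar_bp_form[OF that] cinner_commute[of y v]
        H.ip_commute[OF S(2)[OF that(1)] S(2)[OF that(2)]] complex_cnj_cancel_iff ..
    then show ?thesis
      using S_eq_\<Gamma>s_iff_inner[of x y] S_eq_\<Gamma>s_iff[of x y]
      by (auto simp: bp_DtN_def form_operator_def)
  qed
  then show ?thesis by auto
qed

lemma S_adj_S_eq: "bp_S_graph D h \<Gamma> O bp_S_adj D h \<Gamma> = {(B y, y) |y. True}"
proof -
  have "(x, y) \<in> bp_S_graph D h \<Gamma> O bp_S_adj D h \<Gamma> \<longleftrightarrow> x \<in> \<Gamma> ` D \<and> S x = \<Gamma>s y" for x y
  proof -
    have "(x, y) \<in> bp_S_graph D h \<Gamma> O bp_S_adj D h \<Gamma> \<longleftrightarrow>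
        x \<in> \<Gamma> ` D \<and> S x \<in> D \<and> (\<forall>v\<in>\<Gamma> ` D. ip1 (S v) (S x) = cinner v y)"
      by (auto simp: relcomp_unfold bp_S_graph_def bp_S_adj_def graph_on_def op_adjoint_def)
    then show ?thesis using S_eq_\<Gamma>s_iff_inner S(2) by blast
  qed
  then show ?thesis using S_eq_\<Gamma>s_iff by (auto simp: set_eq_iff)
qed

lemma \<Gamma>_\<Gamma>_adj_eq: "bp_\<Gamma>_adj D h \<Gamma> O graph_on D \<Gamma> = {(y, B y) |y. True}"
proof -
  have "bp_\<Gamma>_adj D h \<Gamma> = {(y, \<Gamma>s y) |y. True}"
    using \<Gamma>s \<Gamma>s_unique by (auto simp: bp_\<Gamma>_adj_def op_adjoint_def graph_on_def)
  then show ?thesis using \<Gamma>s(1) by (auto simp: graph_on_def B_def relcomp_unfold)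
qed

section \<open>Lower bounds and their optimality\<close>

abbreviation \<Lambda> :: "('g \<times> 'g) set" where "\<Lambda> \<equiv> bp_DtN D h \<Gamma>"

lemma op_ge_DtN: "op_ge \<Lambda> (1 / ereal (M\<^sup>2))"
  unfolding op_ge_def DtN_eq
proof clarify
  fix y
  have "0 \<le> Re (cinner y (B y))" "cinner y (B y) \<in> \<real>" by (simp_all add: cinner_B_self)
  then show "cinner y (B y) \<in> \<real> \<and>
      1 / ereal (M\<^sup>2) * ereal ((norm (B y))\<^sup>2) \<le> ereal (Re (cinner y (B y)))"
    by (intro conjI one_divide_ereal_mult_le norm_B_square_le) auto
qed

lemma form_ge_bp_form: "form_ge (\<Gamma> ` D) (bp_form D h \<Gamma>) (1 / ereal (M\<^sup>2))"
  unfolding form_ge_def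
proof
  fix \<phi> assume \<phi>: "\<phi> \<in> \<Gamma> ` D"
  have "norm \<phi> \<le> M * n1 (S \<phi>)" using norm_\<Gamma>_le[OF S(2)[OF \<phi>]] S(3)[OF \<phi>] by simp
  then have "(norm \<phi>)\<^sup>2 \<le> (M * n1 (S \<phi>))\<^sup>2" by (intro power_mono) auto
  then show "1 / ereal (M\<^sup>2) * ereal ((norm \<phi>)\<^sup>2) \<le> ereal (bp_form D h \<Gamma> \<phi>)"
    by (intro one_divide_ereal_mult_le) (auto simp: bp_form_def power_mult_distrib)
qed

text \<open>The assumption bounds \<open>\<Gamma>\<close> by \<open>1 / sqrt r\<close>, and
  \<open>M\<close> is the least such bound.\<close>

lemma mult_M_square_le:
  assumes r: "r > 0" and le: "\<And>u. u \<in> D \<Longrightarrow> r * (norm (\<Gamma> u))\<^sup>2 \<le> (n1 u)\<^sup>2"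
  shows "r * M\<^sup>2 \<le> 1"
proof -
  have "norm (\<Gamma> u) \<le> (1 / sqrt r) * n1 u" if u: "u \<in> D" for u
  proof (rule power2_le_imp_le)
    show "(norm (\<Gamma> u))\<^sup>2 \<le> (1 / sqrt r * n1 u)\<^sup>2"
      using le[OF u] r by (simp add: power_mult_distrib power_divide field_simps)
  qed (use r n1_nonneg[OF u] in simp)
  then have "M \<le> 1 / sqrt r" using r by (intro M_le) auto
  then have "M\<^sup>2 \<le> (1 / sqrt r)\<^sup>2" using M_nonneg by (rule power_mono)
  then show ?thesis using r by (simp add: power_divide field_simps)
qed

lemma form_ge_optimal:
  assumes "form_ge (\<Gamma> ` D) (bp_form D h \<Gamma>) c"
  shows "c \<le> 1 / ereal (M\<^sup>2)"
proof (rule ereal_le_one_divide)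
  fix r :: real assume r: "r > 0" "ereal r \<le> c"
  show "r * M\<^sup>2 \<le> 1"
  proof (rule mult_M_square_le)
    fix u assume u: "u \<in> D"
    have "ereal r * ereal ((norm (\<Gamma> u))\<^sup>2) \<le> c * ereal ((norm (\<Gamma> u))\<^sup>2)"
      using r by (intro ereal_mult_right_mono) auto
    also have "\<dots> \<le> ereal ((n1 (S (\<Gamma> u)))\<^sup>2)"
      using assms u by (auto simp: form_ge_def bp_form_def)
    finally have "r * (norm (\<Gamma> u))\<^sup>2 \<le> (n1 (S (\<Gamma> u)))\<^sup>2" by simp
    also have "\<dots> \<le> (n1 u)\<^sup>2"
      using n1_S_le[OF u] n1_nonneg[OF S(2)] u by (intro power_mono) auto
    finally show "r * (norm (\<Gamma> u))\<^sup>2 \<le> (n1 u)\<^sup>2" .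
  qed fact
qed simp

text \<open>The assumption gives \<open>r * norm (B y) \<le> norm y\<close>. Since
  \<open>cinner y (B y)\<close> is the squared form norm of \<open>\<Gamma>s y\<close>, this bounds
  \<open>\<Gamma>s\<close>, and duality carries the bound over to \<open>\<Gamma>\<close>.\<close>

lemma B_coercive_optimal:
  assumes r: "r > 0" and le: "\<And>y. r * (norm (B y))\<^sup>2 \<le> Re (cinner y (B y))"
  shows "r * M\<^sup>2 \<le> 1"
proof (rule mult_M_square_le[OF r])
  have \<Gamma>s_le: "r * (n1 (\<Gamma>s y))\<^sup>2 \<le> (norm y)\<^sup>2" for y
  proof -
    have "r * (norm (B y) * norm (B y)) \<le> norm y * norm (B y)"
      using le[of y] G.Re_ip_le[of y "B y"] by (simp add: power2_eq_square)
    then have "r * norm (B y) \<le> norm y" by (cases "B y = 0") (auto simp flip: mult.assoc)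
    then have "norm y * (r * norm (B y)) \<le> norm y * norm y" by (intro mult_left_mono) auto
    moreover have "r * Re (cinner y (B y)) \<le> r * (norm y * norm (B y))"
      using r by (intro mult_left_mono G.Re_ip_le) auto
    ultimately show ?thesis by (simp add: cinner_B_self power2_eq_square mult_ac)
  qed
  fix u assume u: "u \<in> D"
  define a where "a = norm (\<Gamma> u)"
  \<comment> \<open>The duality step: \<open>\<Gamma>s\<close> is applied to
    \<open>\<Gamma> u\<close> itself.\<close>
  have "a\<^sup>2 = Re (ip1 u (\<Gamma>s (\<Gamma> u)))" using u by (simp add: \<Gamma>s cinner_self a_def)
  also have "\<dots> \<le> n1 u * n1 (\<Gamma>s (\<Gamma> u))" using u \<Gamma>s(1) by (rule Re_ip1_le)
  finally have "(a\<^sup>2)\<^sup>2 \<le> (n1 u * n1 (\<Gamma>s (\<Gamma> u)))\<^sup>2" by (intro power_mono) auto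
  then have "r * (a\<^sup>2)\<^sup>2 \<le> r * (n1 u * n1 (\<Gamma>s (\<Gamma> u)))\<^sup>2" using r by (intro mult_left_mono) auto
  also have "\<dots> = (n1 u)\<^sup>2 * (r * (n1 (\<Gamma>s (\<Gamma> u)))\<^sup>2)" by (simp add: power_mult_distrib mult_ac)
  also have "\<dots> \<le> (n1 u)\<^sup>2 * a\<^sup>2" unfolding a_def by (intro mult_left_mono \<Gamma>s_le) auto
  finally have "(r * a\<^sup>2) * a\<^sup>2 \<le> (n1 u)\<^sup>2 * a\<^sup>2" by (simp add: power2_eq_square mult_ac)
  then show "r * (norm (\<Gamma> u))\<^sup>2 \<le> (n1 u)\<^sup>2"
    by (cases "a = 0") (auto simp: a_def[symmetric] mult_le_cancel_right)
qed

lemma op_ge_optimal: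
  assumes "op_ge \<Lambda> c"
  shows "c \<le> 1 / ereal (M\<^sup>2)"
proof (rule ereal_le_one_divide)
  fix r :: real assume r: "r > 0" "ereal r \<le> c"
  show "r * M\<^sup>2 \<le> 1"
  proof (rule B_coercive_optimal)
    fix y
    have "ereal r * ereal ((norm (B y))\<^sup>2) \<le> c * ereal ((norm (B y))\<^sup>2)"
      using r by (intro ereal_mult_right_mono) auto
    also have "\<dots> \<le> ereal (Re (cinner y (B y)))"
      using assms by (auto simp: op_ge_def DtN_eq)
    finally show "r * (norm (B y))\<^sup>2 \<le> Re (cinner y (B y))" by simp
  qed fact
qed simp

section \<open>The inverse, the resolvent set and the spectrum\<close>

lemma bounded_operator_converse_DtN: "bounded_operator (converse \<Lambda>)"
  and op_norm_converse_DtN_le: "op_norm norm norm (converse \<Lambda>) \<le> M\<^sup>2"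
proof -
  have eq: "converse \<Lambda> = {(y, B y) |y. True}" by (auto simp: DtN_eq)
  have "B 0 = 0" using B_scaleC[of 0 0] by simp
  then show "bounded_operator (converse \<Lambda>)"
    unfolding bounded_operator_def eq op_bounded_def linear_relation_def
    by (auto simp: single_valued_def B_add B_scaleC intro!: exI[of _ "M\<^sup>2"] norm_B_le)
  show "op_norm norm norm (converse \<Lambda>) \<le> M\<^sup>2"
    unfolding op_norm_def
  proof (rule cSup_least)
    show "{norm y |x y. (x, y) \<in> converse \<Lambda> \<and> norm x \<le> 1} \<noteq> {}"
      unfolding eq by (auto intro!: exI[of _ 0])
    fix t assume "t \<in> {norm y |x y. (x, y) \<in> converse \<Lambda> \<and> norm x \<le> 1}"
    then obtain x where x: "t = norm (B x)" "norm x \<le> 1" unfolding eq by blast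
    show "t \<le> M\<^sup>2"
      using norm_B_le[of x] mult_left_mono[OF x(2), of "M\<^sup>2"] x(1) by simp
  qed
qed

text \<open>At \<open>B y\<close> the operator \<Lambda> - \<open>z\<close> takes the value
  \<open>A z y\<close>, so its inverse is \<open>B\<close> after the inverse of \<open>A z\<close>.
  The assumption avoids division so as to cover \<open>M = 0\<close>, where every \<open>z\<close>
  qualifies.\<close>

lemma resolvent_set_DtN:
  assumes z: "M\<^sup>2 * Re z < 1"
  shows "z \<in> resolvent_set \<Lambda>"
proof -
  define A where "A w y = y - w *\<^sub>C B y" for w y
  define K where "K w = 1 + cmod w * (M\<^sup>2 / (1 - M\<^sup>2 * Re w))" for w
  have below: "norm y \<le> K w * norm (A w y)" if w: "M\<^sup>2 * Re w < 1" for w y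
  proof -
    \<comment> \<open>Pairing \<open>A w y\<close> with \<open>B y\<close> and taking real parts
      leaves only \<open>Re w\<close>, which turns the bound on \<open>B\<close> into a lower bound
      for \<open>A w\<close>.\<close>
    have "(1 - M\<^sup>2 * Re w) * (norm (B y))\<^sup>2 \<le> M\<^sup>2 * (Re (cinner y (B y)) - Re w * (norm (B y))\<^sup>2)"
      using norm_B_square_le[of y] by (simp add: algebra_simps)
    also have "\<dots> = M\<^sup>2 * Re (cinner (A w y) (B y))"
      by (simp add: A_def G.ip_diff_left cinner_scaleC_left cinner_self)
    also have "\<dots> \<le> M\<^sup>2 * (norm (A w y) * norm (B y))"
      by (intro mult_left_mono G.Re_ip_le) auto
    finally have "((1 - M\<^sup>2 * Re w) * norm (B y)) * norm (B y) \<le> (M\<^sup>2 * norm (A w y)) * norm (B y)"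
      by (simp add: power2_eq_square mult_ac)
    then have "(1 - M\<^sup>2 * Re w) * norm (B y) \<le> M\<^sup>2 * norm (A w y)"
      by (cases "B y = 0") auto
    then have "norm (B y) \<le> M\<^sup>2 / (1 - M\<^sup>2 * Re w) * norm (A w y)"
      using w by (simp add: field_simps)
    then have "cmod w * norm (B y) \<le> cmod w * (M\<^sup>2 / (1 - M\<^sup>2 * Re w) * norm (A w y))"
      by (rule mult_left_mono) simp
    moreover have "norm y \<le> norm (A w y) + cmod w * norm (B y)"
      using norm_triangle_ineq[of "A w y" "w *\<^sub>C B y"] by (simp add: A_def norm_scaleC)
    ultimately show ?thesis by (simp add: K_def algebra_simps)
  qed
  have zero: "A w y = 0 \<Longrightarrow> y = 0" if "M\<^sup>2 * Re w < 1" for w y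
    using below[OF that, of y] by simp
  have add: "A w (x + y) = A w x + A w y" and scale: "A w (a *\<^sub>C x) = a *\<^sub>C A w x" for w x y a
    by (simp_all add: A_def B_add B_scaleC scaleC_add_right scaleC_diff_right scaleC_scaleC mult.commute)
  have surj: "surj (A z)"
  proof (rule bounded_below_surj)
    show "clinear_on UNIV (A z)" by (simp add: clinear_on_def add scale)
    show "norm (A z y) \<le> (1 + cmod z * M\<^sup>2) * norm y" for y
      using norm_triangle_ineq4[of y "z *\<^sub>C B y"] mult_left_mono[OF norm_B_le[of y], of "cmod z"]
      by (simp add: A_def norm_scaleC algebra_simps)
    show "norm y \<le> K z * norm (A z y)" for y using below z .
    \<comment> \<open>The adjoint parameter \<open>cnj z\<close> has the same real part as
      \<open>z\<close>, so the same estimate makes the adjoint injective.\<close>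
    show "cinner (A z x) y = cinner x (A (cnj z) y)" for x y
      by (simp add: A_def G.ip_diff_left G.ip_diff_right cinner_scaleC_left cinner_scaleC_right B_sym)
    show "A (cnj z) y = 0 \<Longrightarrow> y = 0" for y using zero[of "cnj z"] z by simp
  qed
  have inj: "x = y" if "A z x = A z y" for x y
    using zero[OF z, of "x - y"] add[of z "x - y" y] that by simp
  have bounded: "norm (B y) \<le> M\<^sup>2 * K z * norm (A z y)" for y
    using norm_B_le[of y] mult_left_mono[OF below[OF z, of y], of "M\<^sup>2"] by (simp add: mult.assoc)
  define T where "T = {(A z y, B y) |y. True}"
  have T: "(A z y, B y) \<in> T" for y by (auto simp: T_def)
  have "single_valued T" unfolding single_valued_def T_def using inj by blast
  moreover have "Domain T = UNIV" using T surj by (metis Domain.DomainI UNIV_eq_I surjD)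
  moreover have "linear_relation T"
    unfolding linear_relation_def
  proof (intro conjI allI ballI)
    show "(0, 0) \<in> T" using T[of 0] scale[of z 0 0] B_scaleC[of 0 0] by simp
  qed (auto simp: T_def simp flip: add scale B_add B_scaleC)
  moreover have "op_bounded norm norm T"
    using bounded by (auto simp: op_bounded_def T_def)
  moreover have "converse {(x, y - z *\<^sub>C x) |x y. (x, y) \<in> \<Lambda>} = T"
    by (auto simp: DtN_eq A_def T_def)
  ultimately show ?thesis
    unfolding resolvent_set_def bounded_operator_def mem_Collect_eq by (intro conjI) simp_all
qed

text \<open>Were \<open>m = 1/M\<^sup>2\<close> in the resolvent set, the non-negative bounded operator \<open>R = (\<Lambda> - m)\<^sup>-\<^sup>1\<close>
  would satisfy \<open>\<parallel>R x\<parallel>\<^sup>2 \<le> \<parallel>R\<parallel> \<langle>R x, x\<rangle>\<close>, which improves the optimal lower bound \<open>m\<close> of \<open>\<Lambda>\<close>.\<close>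

lemma M_inverse_in_spectrum:
  assumes "M > 0"
  shows "complex_of_real (1 / M\<^sup>2) \<in> op_spectrum \<Lambda>"
proof -
  define m where "m = 1 / M\<^sup>2"
  have m: "m > 0" "M\<^sup>2 * m = 1" using assms by (auto simp: m_def)
  have nonneg: "0 \<le> Re (cinner (y - m *\<^sub>R B y) (B y))" for y
  proof -
    have "m * (norm (B y))\<^sup>2 \<le> m * (M\<^sup>2 * Re (cinner y (B y)))"
      using norm_B_square_le m by (intro mult_left_mono) auto
    also have "\<dots> = Re (cinner y (B y))" using m(2) by (simp flip: mult.assoc add: mult.commute)
    finally show ?thesis by (simp add: G.ip_diff_left G.ip_scaleR_left cinner_self)
  qed
  have False if "complex_of_real m \<in> resolvent_set \<Lambda>"
  proof -
    have eq: "converse {(x, y - complex_of_real m *\<^sub>C x) |x y. (x, y) \<in> \<Lambda>} = {(y - m *\<^sub>R B y, B y) |y. True}"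
      by (auto simp: DtN_eq scaleR_scaleC)
    have R: "bounded_operator {(y - m *\<^sub>R B y, B y) |y. True}"
      using that unfolding resolvent_set_def mem_Collect_eq eq .
    then obtain C0 where "\<forall>(x, w)\<in>{(y - m *\<^sub>R B y, B y) |y. True}. norm w \<le> C0 * norm x"
      unfolding bounded_operator_def op_bounded_def by blast
    then have C0: "norm (B y) \<le> C0 * norm (y - m *\<^sub>R B y)" for y by blast
    have surj: "\<exists>y. x = y - m *\<^sub>R B y" for x
    proof -
      have "x \<in> Domain {(y - m *\<^sub>R B y, B y) |y. True}" using R by (simp add: bounded_operator_def)
      then show ?thesis by blast
    qed
    define C where "C = \<bar>C0\<bar> + 1"
    have C: "C > 0" by (simp add: C_def)
    have B_le: "norm (B y) \<le> C * norm (y - m *\<^sub>R B y)" for y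
      by (rule order_trans[OF C0]) (simp add: C_def mult_right_mono)
    have "(m + 1 / C) * (norm (B y))\<^sup>2 \<le> Re (cinner y (B y))" for y
    proof -
      define x w where "x = B y" and "w = y - m *\<^sub>R B y"
      \<comment> \<open>In terms of the resolvent \<open>R\<close>, \<open>x = R w\<close> and
        \<open>x2 = R x\<close>; non-negativity of \<open>R\<close> will be tested at
        \<open>w + t *\<^sub>R x\<close>.\<close>
      obtain y2 where y2: "x = y2 - m *\<^sub>R B y2" using surj by blast
      define x2 where "x2 = B y2"
      \<comment> \<open>The minimiser of \<open>2 * t + t\<^sup>2 * C\<close>, with minimum
        \<open>- 1 / C\<close>.\<close>
      define t where "t = - 1 / C"
      have wx2: "cinner w x2 = cinner x x"
      proof -
        have "cinner w x2 = cinner (B y) y2 - m * cinner (B y) (B y2)"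
          by (simp add: w_def x2_def G.ip_diff_left G.ip_scaleR_left B_sym)
        also have "\<dots> = cinner x (y2 - m *\<^sub>R B y2)"
          by (simp add: x_def G.ip_diff_right G.ip_scaleR_right)
        finally show ?thesis by (simp flip: y2)
      qed
      have "B (y + t *\<^sub>R y2) = x + t *\<^sub>R x2" by (simp add: B_add B_scaleR x_def x2_def)
      moreover have "y + t *\<^sub>R y2 - m *\<^sub>R B (y + t *\<^sub>R y2) = w + t *\<^sub>R x"
        unfolding y2 by (simp add: B_add B_scaleR w_def algebra_simps)
      ultimately have "0 \<le> Re (cinner (w + t *\<^sub>R x) (x + t *\<^sub>R x2))"
        using nonneg[of "y + t *\<^sub>R y2"] by simp
      also have "\<dots> = Re (cinner w x) + 2 * t * (norm x)\<^sup>2 + t\<^sup>2 * Re (cinner x x2)"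
        by (simp add: cinner_add_left cinner_add_right G.ip_scaleR_left G.ip_scaleR_right wx2
            cinner_self power2_eq_square algebra_simps)
      also have "Re (cinner x x2) \<le> norm x * (C * norm x)"
        using G.Re_ip_le[of x x2] mult_left_mono[OF B_le[of y2], of "norm x"]
        by (simp add: x2_def flip: y2)
      finally have "0 \<le> Re (cinner w x) + 2 * t * (norm x)\<^sup>2 + t\<^sup>2 * (norm x * (C * norm x))"
        by (simp add: mult_left_mono)
      also have "\<dots> = Re (cinner w x) - (1 / C) * (norm x)\<^sup>2"
        using C by (simp add: t_def power2_eq_square field_simps)
      finally show ?thesis
        by (simp add: w_def x_def G.ip_diff_left G.ip_scaleR_left cinner_self algebra_simps)
    qed
    \<comment> \<open>The improved bound is impossible, as \<open>m * M\<^sup>2\<close> is already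
      1.\<close>
    then have "(m + 1 / C) * M\<^sup>2 \<le> 1" using m C by (intro B_coercive_optimal add_pos_pos) auto
    moreover have "1 / C * M\<^sup>2 > 0" using C assms by simp
    ultimately show False using m by (simp add: distrib_right mult.commute)
  qed
  then show ?thesis by (auto simp: op_spectrum_def m_def)
qed

text \<open>For \<open>M = 0\<close> the spectrum is empty, its infimum is \<infinity> and the
  reciprocal is 0. Otherwise the infimum is attained at \<open>1 / M\<^sup>2\<close>.\<close>

lemma inf_spectrum_DtN: "ereal (M\<^sup>2) = 1 / inf_spectrum \<Lambda>"
proof (cases "M = 0")
  case True
  then have "op_spectrum \<Lambda> = {}" using resolvent_set_DtN by (auto simp: op_spectrum_def)
  then have "inf_spectrum \<Lambda> = \<infinity>" by (simp add: inf_spectrum_def top_ereal_def)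
  then show ?thesis using True by simp
next
  case False
  then have M: "M > 0" using M_nonneg by simp
  have "inf_spectrum \<Lambda> = ereal (1 / M\<^sup>2)"
    unfolding inf_spectrum_def
  proof (rule INF_eqI)
    fix z assume "z \<in> op_spectrum \<Lambda>"
    then have "\<not> M\<^sup>2 * Re z < 1" using resolvent_set_DtN by (auto simp: op_spectrum_def)
    then show "ereal (1 / M\<^sup>2) \<le> ereal (Re z)" using M by (simp add: field_simps)
  next
    fix y assume "\<And>z. z \<in> op_spectrum \<Lambda> \<Longrightarrow> y \<le> ereal (Re z)"
    then show "y \<le> ereal (1 / M\<^sup>2)" using M_inverse_in_spectrum[OF M] by fastforce
  qed
  then show ?thesis using M by (simp add: one_ereal_def)
qed

section \<open>Boundedness of \<Lambda> and surjectivity of the boundary map\<close>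

lemma ran_eq_UNIV_if_op_bounded:
  assumes "op_bounded norm norm \<Lambda>"
  shows "\<Gamma> ` D = UNIV"
proof -
  obtain C where C: "\<And>y. norm y \<le> C * norm (B y)"
    using assms by (auto simp: op_bounded_def DtN_eq)
  have "surj B"
    by (rule bounded_below_surj[OF clinear_B norm_B_le C B_sym B_inj])
  then show ?thesis using \<Gamma>s(1) by (auto simp: B_def surj_def image_iff)
qed

lemma op_bounded_if_ran_eq_UNIV:
  assumes "\<Gamma> ` D = UNIV"
  shows "op_bounded norm norm \<Lambda>"
proof -
  have "\<exists>C. \<forall>y\<in>{y. n1 (\<Gamma>s y) \<le> 1}. norm y \<le> C"
  proof (rule weakly_bounded_imp_bounded)
    fix x
    obtain u where u: "u \<in> D" "x = \<Gamma> u" using assms by (metis UNIV_I imageE)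
    have "Re (cinner x y) \<le> n1 u" if "n1 (\<Gamma>s y) \<le> 1" for y
    proof -
      have "Re (cinner x y) \<le> n1 u * n1 (\<Gamma>s y)"
        using Re_ip1_le[OF u(1) \<Gamma>s(1), of y] u by (simp add: \<Gamma>s)
      also have "\<dots> \<le> n1 u" using mult_left_mono[OF that n1_nonneg[OF u(1)]] by simp
      finally show ?thesis .
    qed
    then show "\<exists>C. \<forall>y\<in>{y. n1 (\<Gamma>s y) \<le> 1}. Re (cinner x y) \<le> C" by blast
  qed
  then obtain C where C: "\<And>y. n1 (\<Gamma>s y) \<le> 1 \<Longrightarrow> norm y \<le> C" by blast
  have le: "norm y \<le> C * n1 (\<Gamma>s y)" for y
  proof (cases "y = 0")
    case True
    have "\<Gamma>s 0 = 0" by (rule \<Gamma>s_unique) auto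
    then show ?thesis using True by simp
  next
    case False
    define s where "s = n1 (\<Gamma>s y)"
    \<comment> \<open>Rescaling to \<open>s = 1\<close> is possible because \<open>B\<close> is
      injective.\<close>
    have "s \<noteq> 0"
    proof
      assume "s = 0"
      then have "B y = 0" using norm_B_le_\<Gamma>s[of y] by (simp add: s_def)
      then show False using B_inj False by blast
    qed
    then have s: "s > 0" using n1_nonneg[OF \<Gamma>s(1), of y] by (simp add: s_def)
    have "\<Gamma>s ((1 / s) *\<^sub>R y) = (1 / s) *\<^sub>R \<Gamma>s y"
      using clinear_\<Gamma>s by (simp add: clinear_on_def scaleR_scaleC)
    then have "n1 (\<Gamma>s ((1 / s) *\<^sub>R y)) = 1"
      using H.nrm_scaleR[OF \<Gamma>s(1), of "1 / s" y] s \<Gamma>s(1) by (simp add: nrm_eq s_def)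
    then show ?thesis using C[of "(1 / s) *\<^sub>R y"] s by (simp add: s_def field_simps)
  qed
  have "norm y \<le> C\<^sup>2 * norm (B y)" for y
  proof -
    \<comment> \<open>Squaring replaces \<open>\<Gamma>s\<close> by \<open>B\<close>, since
      \<open>cinner y (B y)\<close> is the squared form norm of \<open>\<Gamma>s y\<close>;
      Cauchy-Schwarz then lets one factor \<open>norm y\<close> cancel.\<close>
    have "norm y * norm y \<le> C\<^sup>2 * (n1 (\<Gamma>s y))\<^sup>2"
      using power_mono[OF le, of y 2] by (simp add: power_mult_distrib flip: power2_eq_square)
    also have "\<dots> = C\<^sup>2 * Re (cinner y (B y))" by (simp add: cinner_B_self)
    also have "\<dots> \<le> C\<^sup>2 * (norm y * norm (B y))" by (intro mult_left_mono G.Re_ip_le) auto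
    finally have "norm y * norm y \<le> norm y * (C\<^sup>2 * norm (B y))" by (simp add: mult_ac)
    then show ?thesis by (cases "y = 0") auto
  qed
  then show ?thesis by (auto simp: op_bounded_def DtN_eq)
qed

end

theorem theorem2p11:
  fixes D :: "'h::chilbert_space set" and h :: "'h \<Rightarrow> real"
    and \<Gamma> :: "'h \<Rightarrow> 'g::chilbert_space"
  defines "\<Lambda> \<equiv> bp_DtN D h \<Gamma>"
    and "M \<equiv> bp_norm D h \<Gamma>"
  assumes "closed_nonneg_form D h" and "boundary_pair D h \<Gamma>"
  shows
    "(Domain \<Lambda> = Domain (bp_S_graph D h \<Gamma> O bp_S_adj D h \<Gamma>)
      \<and> \<Lambda> = bp_S_graph D h \<Gamma> O bp_S_adj D h \<Gamma>
      \<and> op_ge \<Lambda> (1 / ereal (M\<^sup>2))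
      \<and> converse \<Lambda> = bp_\<Gamma>_adj D h \<Gamma> O graph_on D \<Gamma>
      \<and> bounded_operator (converse \<Lambda>)
      \<and> op_norm norm norm (converse \<Lambda>) \<le> M\<^sup>2)
   \<and> (ereal (M\<^sup>2) = 1 / inf_spectrum \<Lambda>
      \<and> form_ge (\<Gamma> ` D) (bp_form D h \<Gamma>) (1 / ereal (M\<^sup>2))
      \<and> (\<forall>c. form_ge (\<Gamma> ` D) (bp_form D h \<Gamma>) c \<longrightarrow> c \<le> 1 / ereal (M\<^sup>2))
      \<and> op_ge \<Lambda> (1 / ereal (M\<^sup>2))
      \<and> (\<forall>c. op_ge \<Lambda> c \<longrightarrow> c \<le> 1 / ereal (M\<^sup>2)))
   \<and> (\<Gamma> ` D \<subset> UNIV \<longleftrightarrow> \<not> op_bounded norm norm \<Lambda>)"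
proof -
  interpret boundary_pair_of_form D h \<Gamma>
    using assms(3,4) by unfold_locales
  have converse: "converse (bp_DtN D h \<Gamma>) = bp_\<Gamma>_adj D h \<Gamma> O graph_on D \<Gamma>"
    unfolding \<Gamma>_\<Gamma>_adj_eq DtN_eq by auto
  have unbounded: "\<Gamma> ` D \<subset> UNIV \<longleftrightarrow> \<not> op_bounded norm norm (bp_DtN D h \<Gamma>)"
    using ran_eq_UNIV_if_op_bounded op_bounded_if_ran_eq_UNIV by blast
  have S_adj_S: "bp_DtN D h \<Gamma> = bp_S_graph D h \<Gamma> O bp_S_adj D h \<Gamma>"
    unfolding S_adj_S_eq DtN_eq ..
  show ?thesis
    unfolding \<Lambda>_def M_def
    by (intro conjI allI impI arg_cong[where f = Domain])
      (fact S_adj_S op_ge_DtN converse bounded_operator_converse_DtN op_norm_converse_DtN_le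
        inf_spectrum_DtN form_ge_bp_form unbounded
      | erule form_ge_optimal op_ge_optimal)+
qed

end
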